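(* Let $K$ be a compact Lie group and let $h\in C^\infty({\rm Lie}(K))$ be an ${\rm Ad}$-invariant strictly convex function such that the inverse of the Hessian of $h$ has bounded operator norm, viewed as a function on $T^*K\cong K\times{\rm Lie}(K)$ via $(x,Y)\mapsto h(Y)$. For $\tau\in\mathbb{C}$ with $s={\rm Im}\,\tau>-1$ let $$\kappa_\tau=2(s+1)\,(Y\cdot u(Y)-h(Y)).$$ Then $$\kappa_\tau=-2\,{\rm Im}\,\psi_\tau,\qquad \psi_\tau=-\frac{i}{2}\,e^{\tau X_h}\cdot\kappa_0+\tau h-\alpha_\tau,$$ where $\alpha_\tau$ is the analytic continuation in $t$ of $\alpha_t=\int_0^te^{t'X_h}(\theta(X_h))\,dt'$ and $\theta=\sum_{i=1}^n y^iw_i$ is the canonical symplectic potential on $T^*K$.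
   Context: ${\rm Lie}(K)$ carries an ${\rm Ad}$-invariant inner product (the Killing metric), used to identify $T^*K\cong TK\cong K\times{\rm Lie}(K)$ by left translations. $\{y^i\}_{i=1}^n$ are the cartesian coordinates of $Y\in{\rm Lie}(K)$ in an orthonormal basis, $u^i=\partial h/\partial y^i$, $u(Y)\in{\rm Lie}(K)$ is the vector with components $u^i$, and $Y\cdot u(Y)=\sum_i y^iu^i$. $\{X_i\}$ is the frame of left-invariant vector fields on $K\times{\rm Lie}(K)$ with zero component along ${\rm Lie}(K)$ corresponding to the chosen basis, and $\{w_i\}$ is the dual frame of left-invariant 1-forms on $K$, pulled back to $T^*K$. The symplectic form is $\omega=-d\theta$, and $X_h$ is the Hamiltonian vector field, $\iota_{X_h}\omega=dh$. $e^{\tau X_h}\cdot f=\sum_{k\ge0}\frac{\tau^k}{k!}X_h^k(f)$ (Lie series). Background: the map $T^*K\to K_{\mathbb{C}}$, $(x,Y)\mapsto xe^{iu(Y)}$, is a diffeomorphism to the complexification $K_{\mathbb{C}}$ of $K$ and defines a complex structure $J_0$ on $T^*K$ for which $(T^*K,\omega,J_0)$ is K\"ahler; the map $(x,Y)\mapsto xe^{(i+\tau)u(Y)}$ similarly defines $J_\tau$ for $s>-1$, and $\kappa_\tau$ is a K\"ahler potential for $(T^*K,\omega,J_\tau)$. *)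

theory Defs
  imports "HOL-Complex_Analysis.Complex_Analysis" "HOL-Algebra.Group"
begin

text \<open>
  The spaces below are real vector spaces of class \<^class>\<open>real_inner\<close> (or \<^class>\<open>real_normed_vector\<close>)
  that are assumed to be finite-dimensional where they occur, rather than of class
  \<^class>\<open>euclidean_space\<close>, because the latter excludes dimension 0 (that is, finite groups).
  \<open>Ck_on\<close> is meant for open sets in finite-dimensional spaces, where continuity of all
  directional derivatives is the same as continuity of the derivative.
\<close>

primrec Ck_on :: "nat \<Rightarrow> ('a::real_normed_vector \<Rightarrow> 'b::real_normed_vector) \<Rightarrow> 'a set \<Rightarrow> bool" where
  "Ck_on 0 f S \<longleftrightarrow> continuous_on S f"
| "Ck_on (Suc k) f S \<longleftrightarrow>
     (\<forall>x\<in>S. f differentiable (at x)) \<and> (\<forall>v. Ck_on k (\<lambda>x. frechet_derivative f (at x) v) S)"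

definition smooth_on :: "('a::real_normed_vector \<Rightarrow> 'b::real_normed_vector) \<Rightarrow> 'a set \<Rightarrow> bool" where
  "smooth_on f S \<longleftrightarrow> (\<forall>k. Ck_on k f S)"

type_synonym ('m, 'e) chart = "'m set \<times> ('m \<Rightarrow> 'e)"
type_synonym ('m, 'e) atlas = "('m, 'e) chart set"

text \<open>A chart is given by its domain \<open>U\<close> and the map \<open>\<phi>\<close>, whose values outside \<open>U\<close> are irrelevant.\<close>

locale smooth_manifold =
  fixes A :: "('m::{t2_space, second_countable_topology}, 'e::real_inner) atlas"
  assumes finite_dim: "\<exists>B::'e set. finite B \<and> span B = UNIV"
    and chart: "(U, \<phi>) \<in> A \<Longrightarrow>
      open U \<and> open (\<phi> ` U) \<and> inj_on \<phi> U \<and> homeomorphism U (\<phi> ` U) \<phi> (the_inv_into U \<phi>)"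
    and cover: "\<exists>(U, \<phi>)\<in>A. p \<in> U"
    and transition: "(U, \<phi>) \<in> A \<Longrightarrow> (V, \<psi>) \<in> A \<Longrightarrow>
      smooth_on (\<psi> \<circ> the_inv_into U \<phi>) (\<phi> ` (U \<inter> V))"

definition prod_atlas ::
    "('m, 'e) atlas \<Rightarrow> ('n, 'f) atlas \<Rightarrow> ('m \<times> 'n, 'e \<times> 'f) atlas" where
  "prod_atlas A B = {(U \<times> V, map_prod \<phi> \<psi>) | U \<phi> V \<psi>. (U, \<phi>) \<in> A \<and> (V, \<psi>) \<in> B}"

definition smooth_map ::
    "('m::topological_space, 'e::real_normed_vector) atlas \<Rightarrow>
     ('n::topological_space, 'f::real_normed_vector) atlas \<Rightarrow> ('m \<Rightarrow> 'n) \<Rightarrow> bool" where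
  "smooth_map A B F \<longleftrightarrow> continuous_on UNIV F \<and>
     (\<forall>(U, \<phi>)\<in>A. \<forall>(V, \<psi>)\<in>B. smooth_on (\<psi> \<circ> F \<circ> the_inv_into U \<phi>) (\<phi> ` (U \<inter> F -` V)))"

definition smooth_fun :: "('m, 'e::real_normed_vector) atlas \<Rightarrow> ('m \<Rightarrow> real) \<Rightarrow> bool" where
  "smooth_fun A f \<longleftrightarrow> (\<forall>(U, \<phi>)\<in>A. smooth_on (f \<circ> the_inv_into U \<phi>) (\<phi> ` U))"

text \<open>
  Tangent vectors at \<open>p\<close> are the directional derivatives at \<open>p\<close> (in charts), as functionals on the
  smooth functions.  All functionals are set to 0 on functions that are not smooth, so that
  equality of functionals is equality of tangent vectors.
\<close>

type_synonym 'm tvec = "('m \<Rightarrow> real) \<Rightarrow> real"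

definition tvec_of :: "('m, 'e::real_normed_vector) atlas \<Rightarrow> ('m, 'e) chart \<Rightarrow> 'm \<Rightarrow> 'e \<Rightarrow> 'm tvec" where
  "tvec_of A c p v = (\<lambda>f. if smooth_fun A f
     then frechet_derivative (f \<circ> the_inv_into (fst c) (snd c)) (at (snd c p)) v else 0)"

definition tangent_space :: "('m, 'e::real_normed_vector) atlas \<Rightarrow> 'm \<Rightarrow> 'm tvec set" where
  "tangent_space A p = {tvec_of A (U, \<phi>) p v | U \<phi> v. (U, \<phi>) \<in> A \<and> p \<in> U}"

definition pushforward ::
    "('m, 'e::real_normed_vector) atlas \<Rightarrow> ('n, 'f::real_normed_vector) atlas \<Rightarrow>
     ('m \<Rightarrow> 'n) \<Rightarrow> 'm tvec \<Rightarrow> 'n tvec" where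
  "pushforward A B F v = (\<lambda>f. if smooth_fun B f then v (f \<circ> F) else 0)"

definition vector_field :: "('m, 'e::real_normed_vector) atlas \<Rightarrow> ('m \<Rightarrow> 'm tvec) \<Rightarrow> bool" where
  "vector_field A X \<longleftrightarrow> (\<forall>(U, \<phi>)\<in>A. \<exists>v. smooth_on v (\<phi> ` U) \<and>
     (\<forall>p\<in>U. X p = tvec_of A (U, \<phi>) p (v (\<phi> p))))"

definition vf_apply :: "('m \<Rightarrow> 'm tvec) \<Rightarrow> ('m \<Rightarrow> real) \<Rightarrow> 'm \<Rightarrow> real" where
  "vf_apply X f = (\<lambda>p. X p f)"

definition lie_bracket :: "('m \<Rightarrow> 'm tvec) \<Rightarrow> ('m \<Rightarrow> 'm tvec) \<Rightarrow> 'm \<Rightarrow> 'm tvec" where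
  "lie_bracket X Z = (\<lambda>p f. X p (vf_apply Z f) - Z p (vf_apply X f))"

type_synonym 'm one_form = "'m \<Rightarrow> 'm tvec \<Rightarrow> real"

text \<open>The exterior derivative of a 1-form, evaluated on two vector fields, in the convention
  without the factor 1/2, so that for instance \<open>d(f dg) = df \<otimes> dg - dg \<otimes> df\<close>.\<close>

definition ext_deriv ::
    "'m one_form \<Rightarrow> ('m \<Rightarrow> 'm tvec) \<Rightarrow> ('m \<Rightarrow> 'm tvec) \<Rightarrow> 'm \<Rightarrow> real" where
  "ext_deriv \<theta> X Z p =
     X p (\<lambda>q. \<theta> q (Z q)) - Z p (\<lambda>q. \<theta> q (X q)) - \<theta> p (lie_bracket X Z p)"

text \<open>\<open>\<iota>\<^sub>X \<omega> = dH\<close> for \<open>\<omega> = - d\<theta>\<close>.\<close>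

definition is_hamiltonian_field ::
    "('m, 'e::real_normed_vector) atlas \<Rightarrow> 'm one_form \<Rightarrow> ('m \<Rightarrow> real) \<Rightarrow> ('m \<Rightarrow> 'm tvec) \<Rightarrow> bool" where
  "is_hamiltonian_field A \<theta> H X \<longleftrightarrow> vector_field A X \<and>
     (\<forall>Z. vector_field A Z \<longrightarrow> (\<forall>p. - ext_deriv \<theta> X Z p = Z p H))"

definition hamiltonian_field ::
    "('m, 'e::real_normed_vector) atlas \<Rightarrow> 'm one_form \<Rightarrow> ('m \<Rightarrow> real) \<Rightarrow> 'm \<Rightarrow> 'm tvec" where
  "hamiltonian_field A \<theta> H = (THE X. is_hamiltonian_field A \<theta> H X)"

definition lie_term :: "complex \<Rightarrow> ('m \<Rightarrow> 'm tvec) \<Rightarrow> ('m \<Rightarrow> real) \<Rightarrow> 'm \<Rightarrow> nat \<Rightarrow> complex" where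
  "lie_term \<tau> X f p k = \<tau> ^ k / fact k * complex_of_real ((vf_apply X ^^ k) f p)"

definition lie_series :: "complex \<Rightarrow> ('m \<Rightarrow> 'm tvec) \<Rightarrow> ('m \<Rightarrow> real) \<Rightarrow> 'm \<Rightarrow> complex" where
  "lie_series \<tau> X f p = (\<Sum>k. lie_term \<tau> X f p k)"

text \<open>\<open>w\<close> is a value at \<open>\<tau>\<close> of an analytic continuation of \<open>f\<close> from the real line.\<close>

definition continuation_value :: "(real \<Rightarrow> complex) \<Rightarrow> complex \<Rightarrow> complex \<Rightarrow> bool" where
  "continuation_value f \<tau> w \<longleftrightarrow> (\<exists>D g. open D \<and> connected D \<and> \<real> \<subseteq> D \<and> \<tau> \<in> D \<and>
     g holomorphic_on D \<and> (\<forall>t::real. g (complex_of_real t) = f t) \<and> w = g \<tau>)"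

definition continuation :: "(real \<Rightarrow> complex) \<Rightarrow> complex \<Rightarrow> complex" where
  "continuation f \<tau> = (THE w. continuation_value f \<tau> w)"

locale compact_lie_group = smooth_manifold A + group K
  for K :: "'k::{t2_space, second_countable_topology} monoid"
    and A :: "('k, 'e::real_inner) atlas" +
  assumes carrier_eq: "carrier K = UNIV"
    and compact_space: "compact (UNIV :: 'k set)"
    and smooth_mult: "smooth_map (prod_atlas A A) A (\<lambda>(x, y). x \<otimes>\<^bsub>K\<^esub> y)"
    and smooth_inv: "smooth_map A A (\<lambda>x. inv\<^bsub>K\<^esub> x)"

text \<open>
  The Lie algebra is the tangent space at the identity.  A choice of inner product on it is encoded
  as a linear isomorphism \<open>L\<close> from an inner product space \<open>'g\<close> onto it; points of Lie(K) are then
  written as elements of \<open>'g\<close>.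
\<close>

definition lie_algebra_iso ::
    "'k monoid \<Rightarrow> ('k, 'e::real_normed_vector) atlas \<Rightarrow> ('g::real_inner \<Rightarrow> 'k tvec) \<Rightarrow> bool" where
  "lie_algebra_iso K A L \<longleftrightarrow>
     bij_betw L UNIV (tangent_space A \<one>\<^bsub>K\<^esub>) \<and> (\<forall>f. linear (\<lambda>Y. L Y f))"

definition Ad ::
    "'k monoid \<Rightarrow> ('k, 'e::real_normed_vector) atlas \<Rightarrow> ('g::real_inner \<Rightarrow> 'k tvec) \<Rightarrow> 'k \<Rightarrow> 'g \<Rightarrow> 'g" where
  "Ad K A L g Y = the_inv L (pushforward A A (\<lambda>x. g \<otimes>\<^bsub>K\<^esub> x \<otimes>\<^bsub>K\<^esub> inv\<^bsub>K\<^esub> g) (L Y))"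

definition orthonormal_basis :: "nat \<Rightarrow> (nat \<Rightarrow> 'g::real_inner) \<Rightarrow> bool" where
  "orthonormal_basis n e \<longleftrightarrow>
     (\<forall>i<n. \<forall>j<n. e i \<bullet> e j = (if i = j then 1 else 0)) \<and> span (e ` {..<n}) = UNIV"

definition left_invariant ::
    "'k monoid \<Rightarrow> ('k, 'e::real_normed_vector) atlas \<Rightarrow> 'k tvec \<Rightarrow> 'k \<Rightarrow> 'k tvec" where
  "left_invariant K A v x = pushforward A A (\<lambda>z. x \<otimes>\<^bsub>K\<^esub> z) v"

text \<open>The 1-forms \<open>w\<^sub>i\<close> dual to the left-invariant frame: \<open>w\<^sub>i(v)\<close> is the \<open>i\<close>-th coefficient of \<open>v\<close>
  in this frame.\<close>

definition dual_frame ::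
    "'k monoid \<Rightarrow> ('k, 'e::real_normed_vector) atlas \<Rightarrow> ('g::real_inner \<Rightarrow> 'k tvec) \<Rightarrow>
     nat \<Rightarrow> (nat \<Rightarrow> 'g) \<Rightarrow> nat \<Rightarrow> 'k one_form" where
  "dual_frame K A L n e i x v =
     (THE c. (\<forall>j\<ge>n. c j = 0) \<and>
        v = (\<lambda>f. \<Sum>j<n. c j * left_invariant K A (L (e j)) x f)) i"

definition cotangent_atlas :: "('k, 'e) atlas \<Rightarrow> ('k \<times> 'g, 'e \<times> 'g) atlas" where
  "cotangent_atlas A = prod_atlas A {(UNIV, id)}"

definition canonical_form ::
    "'k monoid \<Rightarrow> ('k, 'e::real_normed_vector) atlas \<Rightarrow> ('g::real_inner \<Rightarrow> 'k tvec) \<Rightarrow>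
     nat \<Rightarrow> (nat \<Rightarrow> 'g) \<Rightarrow> ('k \<times> 'g) one_form" where
  "canonical_form K A L n e = (\<lambda>(x, Y) V.
     \<Sum>i<n. (Y \<bullet> e i) * dual_frame K A L n e i x (pushforward (cotangent_atlas A) A fst V))"

definition strictly_convex :: "('g::real_vector \<Rightarrow> real) \<Rightarrow> bool" where
  "strictly_convex h \<longleftrightarrow> (\<forall>x y t. x \<noteq> y \<longrightarrow> 0 < t \<longrightarrow> t < 1 \<longrightarrow>
     h ((1 - t) *\<^sub>R x + t *\<^sub>R y) < (1 - t) * h x + t * h y)"

definition partial :: "(nat \<Rightarrow> 'g::real_normed_vector) \<Rightarrow> nat \<Rightarrow> ('g \<Rightarrow> real) \<Rightarrow> 'g \<Rightarrow> real" where
  "partial e i h Y = frechet_derivative h (at Y) (e i)"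

definition grad :: "nat \<Rightarrow> (nat \<Rightarrow> 'g::real_inner) \<Rightarrow> ('g \<Rightarrow> real) \<Rightarrow> 'g \<Rightarrow> 'g" where
  "grad n e h Y = (\<Sum>i<n. partial e i h Y *\<^sub>R e i)"

definition hessian :: "nat \<Rightarrow> (nat \<Rightarrow> 'g::real_inner) \<Rightarrow> ('g \<Rightarrow> real) \<Rightarrow> 'g \<Rightarrow> 'g \<Rightarrow> 'g" where
  "hessian n e h Y v =
     (\<Sum>i<n. (\<Sum>j<n. partial e j (partial e i h) Y * (v \<bullet> e j)) *\<^sub>R e i)"

definition kappa ::
    "nat \<Rightarrow> (nat \<Rightarrow> 'g::real_inner) \<Rightarrow> ('g \<Rightarrow> real) \<Rightarrow> complex \<Rightarrow> 'k \<times> 'g \<Rightarrow> real" where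
  "kappa n e h \<tau> = (\<lambda>(x, Y). 2 * (Im \<tau> + 1) * (Y \<bullet> grad n e h Y - h Y))"

end

theory Submission
  imports Defs
begin

text \<open>
  In the trivialisation of the cotangent bundle by left translations, the Hamiltonian field of a
  function \<open>h\<close> of \<open>Y\<close> alone is \<open>X\<^sub>h = \<Sum>\<^sub>i u\<^sup>i(Y) X\<^sub>i\<close>: it moves along \<open>K\<close> only.  Everything else
  follows from this.  The field annihilates all functions of \<open>Y\<close>, so \<open>\<kappa>\<^sub>0\<close> and
  \<open>\<theta>(X\<^sub>h) = Y \<cdot> u(Y)\<close> are their own Lie series.  Hence \<open>\<alpha>\<^sub>t = t (Y \<cdot> u(Y))\<close>, which continues to
  \<open>\<tau> (Y \<cdot> u(Y))\<close> and to nothing else by the identity theorem, and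
  \<open>\<psi>\<^sub>\<tau> = - (\<i>/2) \<kappa>\<^sub>0 - \<tau> (Y \<cdot> u(Y) - h(Y))\<close> has imaginary part \<open>- (1 + Im \<tau>) (Y \<cdot> u(Y) - h(Y))\<close>.

  The work lies in the field \<open>X\<^sub>h\<close>.  If \<open>(a, d)\<close> are the components of a field \<open>X\<close> along \<open>K\<close> (in the
  left-invariant frame) and along \<open>Lie(K)\<close>, and \<open>(a', d')\<close> those of \<open>Z\<close>, then
  \<open>d\<theta>(X, Z) = d \<cdot> a' - d' \<cdot> a - Y \<cdot> [a, a']\<close> (lemma \<open>ext_deriv_canonical_form\<close>).  Testing with the
  fields \<open>Z = (0, c)\<close> shows that a Hamiltonian field has \<open>a = u\<close>, and testing with \<open>Z = (b, 0)\<close> then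
  gives \<open>d = 0\<close>, because \<open>Y \<cdot> [u(Y), b] = 0\<close>.  The same identity shows that \<open>(u, 0)\<close> is Hamiltonian.
  It is the infinitesimal form of the invariance of \<open>h\<close> and of the metric (lemma \<open>grad_bracket\<close>).

  Tangent vectors are functionals on globally defined smooth functions, and their coefficients in
  the frame have to be recovered from such functions.  Distinct vectors of the Lie algebra are
  distinct functionals, and by linear algebra this implies that for every \<open>z\<close> some smooth function on
  \<open>K\<close> has derivative \<open>Y \<cdot> z\<close> at the identity in every direction \<open>Y\<close> (lemma \<open>exists_coordinate\<close>).
  The left translates of this function read off the coefficient \<open>a \<cdot> z\<close> everywhere on \<open>K\<close>, and they
  depend smoothly on the translating point, so the coefficients of a smooth field are smooth.
\<close>

section \<open>Finite-dimensional inner product spaces\<close>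

text \<open>
  A property of types instead of the class \<^class>\<open>euclidean_space\<close>: the tangent spaces of a finite
  group have dimension 0.
\<close>

definition finite_dimensional :: "'a::real_inner itself \<Rightarrow> bool" where
  "finite_dimensional T \<longleftrightarrow> (\<exists>B::'a set. finite B \<and> span B = UNIV)"

lemma orthogonal_projection_residual:
  fixes C :: "'a::real_inner set"
  assumes fin: "finite C" and orth: "pairwise orthogonal C" and z: "z \<in> span C"
  shows "(x - (\<Sum>c\<in>C. (x \<bullet> c / (c \<bullet> c)) *\<^sub>R c)) \<bullet> z = 0"
proof -
  let ?y = "\<Sum>c\<in>C. (x \<bullet> c / (c \<bullet> c)) *\<^sub>R c"
  have "(x - ?y) \<bullet> b = 0" if b: "b \<in> C" for b
  proof -
    have "?y \<bullet> b = (\<Sum>c\<in>C. (x \<bullet> c / (c \<bullet> c)) * (c \<bullet> b))"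
      by (simp add: inner_sum_left)
    also have "\<dots> = (\<Sum>c\<in>C. if c = b then x \<bullet> b else 0)"
      using orth b by (intro sum.cong) (auto simp: pairwise_def orthogonal_def)
    also have "\<dots> = x \<bullet> b"
      using fin b by simp
    finally show ?thesis by (simp add: inner_diff_left)
  qed
  then show ?thesis
    using orthogonal_to_span[OF z, of "x - ?y"] by (auto simp: orthogonal_def)
qed

lemma orthogonal_projection_in_span:
  "(\<Sum>c\<in>C. (x \<bullet> c / (c \<bullet> c)) *\<^sub>R c) \<in> span C"
  by (intro span_sum span_scale span_base)

lemma orthogonal_expansion:
  fixes C :: "'a::real_inner set"
  assumes "finite C" "pairwise orthogonal C" "x \<in> span C"
  shows "x = (\<Sum>c\<in>C. (x \<bullet> c / (c \<bullet> c)) *\<^sub>R c)"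
proof -
  let ?y = "\<Sum>c\<in>C. (x \<bullet> c / (c \<bullet> c)) *\<^sub>R c"
  have "x - ?y \<in> span C"
    using assms(3) orthogonal_projection_in_span by (rule span_diff)
  from orthogonal_projection_residual[OF assms(1,2) this, of x] show ?thesis by simp
qed

text \<open>
  Here \<open>C\<close> is an orthogonal basis and \<open>d c\<close> is \<open>c\<close> divided by its squared norm.  The expansion is
  stated for the values of a linear map because it is used to reduce a derivative in a variable
  direction to derivatives in finitely many fixed ones.
\<close>

lemma finite_dimensional_coordinates:
  assumes "finite_dimensional TYPE('a::real_inner)"
  obtains C :: "'a::real_inner set" and d :: "'a \<Rightarrow> 'a" where "finite C"
    "\<And>(f::'a \<Rightarrow> 'b::real_normed_vector) x. linear f \<Longrightarrow> f x = (\<Sum>c\<in>C. (x \<bullet> d c) *\<^sub>R f c)"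
proof -
  obtain B :: "'a set" where "finite B" "span B = UNIV"
    using assms by (auto simp: finite_dimensional_def)
  then obtain C :: "'a set" where C: "finite C" "span C = UNIV" "pairwise orthogonal C"
    using basis_orthogonal by metis
  have "f x = (\<Sum>c\<in>C. (x \<bullet> (c /\<^sub>R (c \<bullet> c))) *\<^sub>R f c)" if lin: "linear f" for f :: "'a \<Rightarrow> 'b" and x
  proof -
    have "x = (\<Sum>c\<in>C. (x \<bullet> (c /\<^sub>R (c \<bullet> c))) *\<^sub>R c)"
      using orthogonal_expansion[of C x] C by (simp add: divide_inverse mult.commute)
    from arg_cong[OF this, of f] show ?thesis
      by (simp only: linear_sum[OF lin] linear_scale[OF lin])
  qed
  then show thesis
    using that[of C "\<lambda>c. c /\<^sub>R (c \<bullet> c)"] C(1) by blast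
qed

lemma finite_dimensional_prod:
  assumes "finite_dimensional TYPE('a::real_inner)" and "finite_dimensional TYPE('b::real_inner)"
  shows "finite_dimensional TYPE('a \<times> 'b)"
proof -
  obtain B :: "'a set" and C :: "'b set"
    where B: "finite B" "span B = UNIV" and C: "finite C" "span C = UNIV"
    using assms by (auto simp: finite_dimensional_def)
  let ?D = "(\<lambda>b. (b, 0)) ` B \<union> (\<lambda>c. (0, c)) ` C"
  have lin: "linear (\<lambda>b::'a. (b, 0::'b))" "linear (\<lambda>c::'b. (0::'a, c))"
    by (auto intro!: linearI)
  have "(x, y) \<in> span ?D" for x y
  proof -
    have "(x, 0) \<in> span ((\<lambda>b. (b, 0::'b)) ` B)" "(0, y) \<in> span ((\<lambda>c. (0::'a, c)) ` C)"
      using linear_span_image[OF lin(1), of B] linear_span_image[OF lin(2), of C] B C by auto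
    then have "(x, 0) \<in> span ?D" "(0, y) \<in> span ?D"
      by (meson span_mono subsetD sup_ge1 sup_ge2)+
    then have "(x, 0) + (0, y) \<in> span ?D" by (rule span_add)
    then show ?thesis by simp
  qed
  then have "span ?D = UNIV" by auto
  moreover have "finite ?D" using B C by simp
  ultimately show ?thesis unfolding finite_dimensional_def by blast
qed

section \<open>Calculus of smooth maps\<close>

lemma Ck_on_Suc_mono: "Ck_on (Suc k) f S \<Longrightarrow> Ck_on k f S"
proof (induction k arbitrary: f)
  case 0
  then show ?case
    by (auto intro!: continuous_at_imp_continuous_on differentiable_imp_continuous_within)
next
  case (Suc k)
  then show ?case by (meson Ck_on.simps(2))
qed

lemma Ck_on_cong:
  assumes "open S" and eq: "\<And>x. x \<in> S \<Longrightarrow> f x = g x" and "Ck_on k f S"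
  shows "Ck_on k g S"
  using eq assms(3)
proof (induction k arbitrary: f g)
  case 0
  then show ?case by (simp cong: continuous_on_cong)
next
  case (Suc k)
  have D: "frechet_derivative g (at x) = frechet_derivative f (at x)" if "x \<in> S" for x
    using frechet_derivative_transform_within_open[of f x S g] Suc.prems \<open>open S\<close> that by simp
  have "g differentiable (at x)" if "x \<in> S" for x
  proof -
    have "(f has_derivative frechet_derivative f (at x)) (at x)"
      using Suc.prems that by (simp add: frechet_derivative_works)
    then have "(g has_derivative frechet_derivative f (at x)) (at x)"
      by (rule has_derivative_transform_within_open[OF _ \<open>open S\<close> that]) (use Suc.prems in auto)
    then show ?thesis by (auto simp: differentiable_def)
  qed
  moreover have "Ck_on k (\<lambda>x. frechet_derivative g (at x) v) S" for v
    using Suc.IH[of "\<lambda>x. frechet_derivative f (at x) v"] Suc.prems D by simp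
  ultimately show ?case by simp
qed

lemma Ck_on_subset: "Ck_on k f S \<Longrightarrow> T \<subseteq> S \<Longrightarrow> Ck_on k f T"
  by (induction k arbitrary: f) (auto intro: continuous_on_subset)

lemma Ck_on_local:
  assumes "\<And>x. x \<in> S \<Longrightarrow> \<exists>T. open T \<and> x \<in> T \<and> Ck_on k f T"
  shows "Ck_on k f S"
  using assms
proof (induction k arbitrary: f)
  case 0
  have "continuous (at x within S) f" if x: "x \<in> S" for x
  proof -
    obtain T where "open T" "x \<in> T" "continuous_on T f"
      using 0 x by auto
    then show ?thesis
      by (simp add: continuous_at_imp_continuous_at_within continuous_on_eq_continuous_at)
  qed
  then show ?case by (simp add: continuous_on_eq_continuous_within)
next
  case (Suc k)
  then show ?case by (simp) (metis)
qed

lemma Ck_on_has_derivative: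
  "Ck_on (Suc k) f S \<Longrightarrow> x \<in> S \<Longrightarrow> (f has_derivative frechet_derivative f (at x)) (at x)"
  by (simp add: frechet_derivative_works)

lemma Ck_on_SucI:
  assumes "open S" and "\<And>x. x \<in> S \<Longrightarrow> (f has_derivative D x) (at x)"
    and "\<And>v. Ck_on k (\<lambda>x. D x v) S"
  shows "Ck_on (Suc k) f S"
proof -
  have "frechet_derivative f (at x) = D x" if "x \<in> S" for x
    using frechet_derivative_at[OF assms(2)[OF that]] by simp
  then have "Ck_on k (\<lambda>x. frechet_derivative f (at x) v) S" for v
    by (intro Ck_on_cong[OF assms(1) _ assms(3)[of v]]) simp
  then show ?thesis
    using assms(2) by (auto simp: differentiable_def)
qed

lemma Ck_on_const: "Ck_on k (\<lambda>x. c) S"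
  by (induction k arbitrary: c) auto

lemma Ck_on_linear_comp:
  assumes "open S" "bounded_linear l" "Ck_on k f S"
  shows "Ck_on k (\<lambda>x. l (f x)) S"
  using assms(3)
proof (induction k arbitrary: f)
  case 0
  then show ?case using bounded_linear.continuous_on[OF assms(2)] by simp
next
  case (Suc k)
  show ?case
  proof (rule Ck_on_SucI[OF assms(1)])
    show "((\<lambda>x. l (f x)) has_derivative (\<lambda>v. l (frechet_derivative f (at x) v))) (at x)"
      if "x \<in> S" for x
      using bounded_linear.has_derivative[OF assms(2) Ck_on_has_derivative[OF Suc.prems that]] .
    show "Ck_on k (\<lambda>x. l (frechet_derivative f (at x) v)) S" for v
      using Suc by simp
  qed
qed

lemma Ck_on_bounded_linear:
  assumes "open S" "bounded_linear l"
  shows "Ck_on k l S"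
proof (cases k)
  case 0
  then show ?thesis
    by (simp add: assms(2) linear_continuous_on)
next
  case (Suc j)
  then show ?thesis
    using Ck_on_SucI[OF assms(1) bounded_linear_imp_has_derivative[OF assms(2)] Ck_on_const] by simp
qed

lemma Ck_on_add:
  assumes "open S" "Ck_on k f S" "Ck_on k g S"
  shows "Ck_on k (\<lambda>x. f x + g x) S"
  using assms(2,3)
proof (induction k arbitrary: f g)
  case 0
  then show ?case by (simp add: continuous_on_add)
next
  case (Suc k)
  show ?case
    by (rule Ck_on_SucI[OF assms(1), where D = "\<lambda>x v. frechet_derivative f (at x) v + frechet_derivative g (at x) v"])
      (use Suc in \<open>auto intro!: has_derivative_add simp: frechet_derivative_works[symmetric]\<close>)
qed

lemma Ck_on_sum:
  assumes "open S" "finite I" "\<And>i. i \<in> I \<Longrightarrow> Ck_on k (f i) S"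
  shows "Ck_on k (\<lambda>x. \<Sum>i\<in>I. f i x) S"
  using assms(2,3) by (induction I rule: finite_induct) (auto intro: Ck_on_const Ck_on_add[OF assms(1)])

lemma Ck_on_bilinear:
  assumes "open S" "bounded_bilinear mul" "Ck_on k f S" "Ck_on k g S"
  shows "Ck_on k (\<lambda>x. mul (f x) (g x)) S"
  using assms(3,4)
proof (induction k arbitrary: f g)
  case 0
  then show ?case using bounded_bilinear.continuous_on[OF assms(2)] by simp
next
  case (Suc k)
  show ?case
  proof (rule Ck_on_SucI[OF assms(1)])
    show "((\<lambda>x. mul (f x) (g x)) has_derivative
       (\<lambda>v. mul (f x) (frechet_derivative g (at x) v) + mul (frechet_derivative f (at x) v) (g x))) (at x)"
      if "x \<in> S" for x
      using bounded_bilinear.FDERIV[OF assms(2) Ck_on_has_derivative[OF Suc.prems(1) that]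
        Ck_on_has_derivative[OF Suc.prems(2) that]] .
    show "Ck_on k (\<lambda>x. mul (f x) (frechet_derivative g (at x) v) +
        mul (frechet_derivative f (at x) v) (g x)) S" for v
      using Suc.IH Ck_on_Suc_mono[OF Suc.prems(1)] Ck_on_Suc_mono[OF Suc.prems(2)] Suc.prems
      by (intro Ck_on_add assms(1)) auto
  qed
qed

lemma Ck_on_Pair:
  assumes "open S" "Ck_on k f S" "Ck_on k g S"
  shows "Ck_on k (\<lambda>x. (f x, g x)) S"
proof -
  have l: "bounded_linear (\<lambda>u. (u, 0))" "bounded_linear (\<lambda>v. (0, v))"
    by (intro bounded_linear_Pair bounded_linear_ident bounded_linear_zero)+
  have "Ck_on k (\<lambda>x. (f x, 0) + (0, g x)) S"
    by (rule Ck_on_add[OF assms(1) Ck_on_linear_comp[OF assms(1) l(1) assms(2)] Ck_on_linear_comp[OF assms(1) l(2) assms(3)]])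
  then show ?thesis by simp
qed

text \<open>
  \<^const>\<open>Ck_on\<close> differentiates in one fixed direction at a time, but the direction \<open>Df(x) v\<close> in the
  derivative \<open>Dg(f(x)) (Df(x) v)\<close> of the composition varies with \<open>x\<close>.  Its expansion in a basis of
  the space in the middle leaves only compositions to which the induction hypothesis applies.
\<close>

lemma Ck_on_compose:
  fixes f :: "'a::real_normed_vector \<Rightarrow> 'b::real_inner" and g :: "'b \<Rightarrow> 'c::real_normed_vector"
  assumes "finite_dimensional TYPE('b)" "open S" "Ck_on k f S" "Ck_on k g T" "f ` S \<subseteq> T"
  shows "Ck_on k (\<lambda>x. g (f x)) S"
  using assms(3-5)
proof (induction k arbitrary: g)
  case 0
  then show ?case
    using continuous_on_compose2 by (simp) blast
next
  case (Suc k)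
  obtain C :: "'b set" and d where C: "finite C"
      "\<And>(f::'b \<Rightarrow> 'c) x. linear f \<Longrightarrow> f x = (\<Sum>c\<in>C. (x \<bullet> d c) *\<^sub>R f c)"
    using finite_dimensional_coordinates[OF assms(1)] by metis
  let ?Df = "\<lambda>x. frechet_derivative f (at x)" and ?Dg = "\<lambda>x. frechet_derivative g (at x)"
  show ?case
  proof (rule Ck_on_SucI[OF assms(2)])
    fix x assume x: "x \<in> S"
    then have fx: "f x \<in> T" using Suc.prems by auto
    have "((\<lambda>x. g (f x)) has_derivative (\<lambda>v. ?Dg (f x) (?Df x v))) (at x)"
      using diff_chain_at[OF Ck_on_has_derivative[OF Suc.prems(1) x] Ck_on_has_derivative[OF Suc.prems(2) fx]]
      by (simp add: o_def)
    moreover have "?Dg (f x) (?Df x v) = (\<Sum>c\<in>C. (?Df x v \<bullet> d c) *\<^sub>R ?Dg (f x) c)" for v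
      using has_derivative_linear[OF Ck_on_has_derivative[OF Suc.prems(2) fx]] by (rule C(2))
    ultimately show "((\<lambda>x. g (f x)) has_derivative
        (\<lambda>v. \<Sum>c\<in>C. (?Df x v \<bullet> d c) *\<^sub>R ?Dg (f x) c)) (at x)"
      by (simp only:)
  next
    fix v
    have "Ck_on k (\<lambda>x. (?Df x v \<bullet> d c) *\<^sub>R ?Dg (f x) c) S" for c
    proof (rule Ck_on_bilinear[OF assms(2) bounded_bilinear_scaleR])
      show "Ck_on k (\<lambda>x. ?Df x v \<bullet> d c) S"
        by (rule Ck_on_linear_comp[OF assms(2) bounded_linear_inner_left]) (use Suc.prems in simp)
      have "Ck_on k (\<lambda>y. ?Dg y c) T" using Suc.prems by simp
      then show "Ck_on k (\<lambda>x. ?Dg (f x) c) S"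
        by (rule Suc.IH[OF Ck_on_Suc_mono[OF Suc.prems(1)] _ Suc.prems(3)])
    qed
    then show "Ck_on k (\<lambda>x. \<Sum>c\<in>C. (?Df x v \<bullet> d c) *\<^sub>R ?Dg (f x) c) S"
      by (rule Ck_on_sum[OF assms(2) C(1)])
  qed
qed

lemma smooth_on_compose:
  fixes f :: "'a::real_normed_vector \<Rightarrow> 'b::real_inner" and g :: "'b \<Rightarrow> 'c::real_normed_vector"
  assumes "finite_dimensional TYPE('b)" "open S" "smooth_on f S" "smooth_on g T" "f ` S \<subseteq> T"
  shows "smooth_on (\<lambda>x. g (f x)) S"
  using assms Ck_on_compose unfolding smooth_on_def by blast

lemma smooth_on_cong:
  "open S \<Longrightarrow> (\<And>x. x \<in> S \<Longrightarrow> f x = g x) \<Longrightarrow> smooth_on f S \<Longrightarrow> smooth_on g S"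
  unfolding smooth_on_def using Ck_on_cong by blast

lemma smooth_on_subset: "smooth_on f S \<Longrightarrow> T \<subseteq> S \<Longrightarrow> smooth_on f T"
  unfolding smooth_on_def using Ck_on_subset by blast

lemma smooth_on_local:
  "(\<And>x. x \<in> S \<Longrightarrow> \<exists>T. open T \<and> x \<in> T \<and> smooth_on f T) \<Longrightarrow> smooth_on f S"
  unfolding smooth_on_def by (intro allI Ck_on_local) meson

lemma smooth_on_const [simp]: "smooth_on (\<lambda>x. c) S"
  by (simp add: smooth_on_def Ck_on_const)

lemma smooth_on_linear_comp:
  "open S \<Longrightarrow> bounded_linear l \<Longrightarrow> smooth_on f S \<Longrightarrow> smooth_on (\<lambda>x. l (f x)) S"
  by (simp add: smooth_on_def Ck_on_linear_comp)

lemma smooth_on_bounded_linear: "open S \<Longrightarrow> bounded_linear l \<Longrightarrow> smooth_on l S"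
  by (simp add: smooth_on_def Ck_on_bounded_linear)

lemma smooth_on_ident: "open S \<Longrightarrow> smooth_on (\<lambda>x. x) S"
  by (rule smooth_on_bounded_linear[OF _ bounded_linear_ident])

lemma smooth_on_fst: "open S \<Longrightarrow> smooth_on fst S"
  by (rule smooth_on_bounded_linear[OF _ bounded_linear_fst])

lemma smooth_on_snd: "open S \<Longrightarrow> smooth_on snd S"
  by (rule smooth_on_bounded_linear[OF _ bounded_linear_snd])

lemma smooth_on_add:
  "open S \<Longrightarrow> smooth_on f S \<Longrightarrow> smooth_on g S \<Longrightarrow> smooth_on (\<lambda>x. f x + g x) S"
  by (simp add: smooth_on_def Ck_on_add)

lemma smooth_on_sum:
  "open S \<Longrightarrow> finite I \<Longrightarrow> (\<And>i. i \<in> I \<Longrightarrow> smooth_on (f i) S) \<Longrightarrow> smooth_on (\<lambda>x. \<Sum>i\<in>I. f i x) S"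
  by (simp add: smooth_on_def Ck_on_sum)

lemma smooth_on_scaleR:
  "open S \<Longrightarrow> smooth_on f S \<Longrightarrow> smooth_on g S \<Longrightarrow> smooth_on (\<lambda>x. f x *\<^sub>R g x) S"
  by (simp add: smooth_on_def Ck_on_bilinear[OF _ bounded_bilinear_scaleR])

lemma smooth_on_mult:
  fixes f g :: "'a::real_normed_vector \<Rightarrow> real"
  shows "open S \<Longrightarrow> smooth_on f S \<Longrightarrow> smooth_on g S \<Longrightarrow> smooth_on (\<lambda>x. f x * g x) S"
  by (simp add: smooth_on_def Ck_on_bilinear[OF _ bounded_bilinear_mult])

lemma smooth_on_Pair:
  "open S \<Longrightarrow> smooth_on f S \<Longrightarrow> smooth_on g S \<Longrightarrow> smooth_on (\<lambda>x. (f x, g x)) S"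
  by (simp add: smooth_on_def Ck_on_Pair)

lemma smooth_on_derivative: "smooth_on f S \<Longrightarrow> smooth_on (\<lambda>x. frechet_derivative f (at x) v) S"
  by (metis smooth_on_def Ck_on.simps(2))

lemma smooth_on_has_derivative:
  "smooth_on f S \<Longrightarrow> x \<in> S \<Longrightarrow> (f has_derivative frechet_derivative f (at x)) (at x)"
  by (meson smooth_on_def Ck_on_has_derivative)

lemma smooth_on_linear_derivative: "smooth_on f S \<Longrightarrow> x \<in> S \<Longrightarrow> linear (frechet_derivative f (at x))"
  using smooth_on_has_derivative has_derivative_linear by blast

lemma smooth_on_continuous_on: "smooth_on f S \<Longrightarrow> continuous_on S f"
  by (metis smooth_on_def Ck_on.simps(1))

text \<open>
  The direction \<open>w\<close> may vary; the expansion in a basis is again what reduces it to fixed directions.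
\<close>

lemma smooth_on_derivative_along:
  fixes w :: "'a::real_normed_vector \<Rightarrow> 'b::real_inner" and f :: "'b \<Rightarrow> 'c::real_normed_vector"
  assumes "finite_dimensional TYPE('b)" "open S" "smooth_on c S" "smooth_on w S"
    and "smooth_on f T" "c ` S \<subseteq> T"
  shows "smooth_on (\<lambda>x. frechet_derivative f (at (c x)) (w x)) S"
proof -
  obtain C :: "'b set" and d where C: "finite C"
      "\<And>(f::'b \<Rightarrow> 'c) x. linear f \<Longrightarrow> f x = (\<Sum>c\<in>C. (x \<bullet> d c) *\<^sub>R f c)"
    using finite_dimensional_coordinates[OF assms(1)] by metis
  have "smooth_on (\<lambda>x. \<Sum>b\<in>C. (w x \<bullet> d b) *\<^sub>R frechet_derivative f (at (c x)) b) S"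
    by (rule smooth_on_sum[OF assms(2) C(1)], rule smooth_on_scaleR[OF assms(2)],
        rule smooth_on_linear_comp[OF assms(2) bounded_linear_inner_left assms(4)],
        rule smooth_on_compose[OF assms(1,2,3) smooth_on_derivative[OF assms(5)] assms(6)])
  moreover have "(\<Sum>b\<in>C. (w x \<bullet> d b) *\<^sub>R frechet_derivative f (at (c x)) b)
      = frechet_derivative f (at (c x)) (w x)" if "x \<in> S" for x
    using assms(6) that by (intro C(2)[symmetric] smooth_on_linear_derivative[OF assms(5)]) auto
  ultimately show ?thesis
    by (rule smooth_on_cong[OF assms(2), rotated])
qed

text \<open>
  The mean value theorem is applied in the direction \<open>v\<close> to the difference of \<open>f\<close> and its translate
  by \<open>s w\<close>, and then in the direction \<open>w\<close> to the derivative of \<open>f\<close> along \<open>v\<close>.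
\<close>

lemma second_difference_mvt:
  fixes f :: "'a::real_normed_vector \<Rightarrow> real"
  assumes f: "smooth_on f S" and s: "0 < s"
    and S: "\<And>a b. 0 \<le> a \<Longrightarrow> a \<le> s \<Longrightarrow> 0 \<le> b \<Longrightarrow> b \<le> s \<Longrightarrow> x + a *\<^sub>R v + b *\<^sub>R w \<in> S"
  obtains a b where "0 < a" "a < s" "0 < b" "b < s"
    "f (x + s *\<^sub>R v + s *\<^sub>R w) - f (x + s *\<^sub>R v) - f (x + s *\<^sub>R w) + f x =
      s * s * frechet_derivative (\<lambda>y. frechet_derivative f (at y) v) (at (x + a *\<^sub>R v + b *\<^sub>R w)) w"
proof -
  define Dv where "Dv = (\<lambda>y. frechet_derivative f (at y) v)"
  have Dv: "smooth_on Dv S"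
    unfolding Dv_def by (rule smooth_on_derivative[OF f])
  have line: "((\<lambda>a. g (z + a *\<^sub>R u)) has_real_derivative frechet_derivative g (at (z + a *\<^sub>R u)) u) (at a)"
    if g: "smooth_on g S" and z: "z + a *\<^sub>R u \<in> S" for g :: "'a \<Rightarrow> real" and z u a
  proof -
    have l: "((\<lambda>a. z + a *\<^sub>R u) has_derivative (\<lambda>r. r *\<^sub>R u)) (at a)"
      by (auto intro!: derivative_eq_intros)
    have "((\<lambda>a. g (z + a *\<^sub>R u)) has_derivative (\<lambda>r. frechet_derivative g (at (z + a *\<^sub>R u)) (r *\<^sub>R u))) (at a)"
      using diff_chain_at[OF l smooth_on_has_derivative[OF g z]] by (simp add: o_def)
    moreover have "(\<lambda>r. frechet_derivative g (at (z + a *\<^sub>R u)) (r *\<^sub>R u)) = (*) (frechet_derivative g (at (z + a *\<^sub>R u)) u)"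
      using linear_scale[OF smooth_on_linear_derivative[OF g z]] by (auto simp: mult.commute)
    ultimately show ?thesis by (simp add: has_field_derivative_def)
  qed
  let ?p = "\<lambda>a. f ((x + s *\<^sub>R w) + a *\<^sub>R v) - f (x + a *\<^sub>R v)"
  have "\<exists>a. 0 < a \<and> a < s \<and> ?p s - ?p 0 = (s - 0) * (Dv ((x + s *\<^sub>R w) + a *\<^sub>R v) - Dv (x + a *\<^sub>R v))"
  proof (rule MVT2[OF s])
    fix a assume "0 \<le> a" "a \<le> s"
    then have "(x + s *\<^sub>R w) + a *\<^sub>R v \<in> S" "x + a *\<^sub>R v \<in> S"
      using S[of a s] S[of a 0] s by (auto simp: algebra_simps)
    then show "(?p has_real_derivative Dv ((x + s *\<^sub>R w) + a *\<^sub>R v) - Dv (x + a *\<^sub>R v)) (at a)"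
      unfolding Dv_def by (intro DERIV_diff line[OF f])
  qed
  then obtain a where a: "0 < a" "a < s" "?p s - ?p 0 = s * (Dv ((x + s *\<^sub>R w) + a *\<^sub>R v) - Dv (x + a *\<^sub>R v))"
    by auto
  let ?q = "\<lambda>b. Dv ((x + a *\<^sub>R v) + b *\<^sub>R w)"
  have "\<exists>b. 0 < b \<and> b < s \<and> ?q s - ?q 0 = (s - 0) * frechet_derivative Dv (at ((x + a *\<^sub>R v) + b *\<^sub>R w)) w"
  proof (rule MVT2[OF s])
    fix b assume "0 \<le> b" "b \<le> s"
    then show "(?q has_real_derivative frechet_derivative Dv (at ((x + a *\<^sub>R v) + b *\<^sub>R w)) w) (at b)"
      using S[of a b] a by (intro line[OF Dv]) auto
  qed
  then obtain b where b: "0 < b" "b < s" "?q s - ?q 0 = s * frechet_derivative Dv (at ((x + a *\<^sub>R v) + b *\<^sub>R w)) w"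
    by auto
  have "?p s - ?p 0 = s * (?q s - ?q 0)"
    using a(3) by (simp add: algebra_simps)
  then show thesis
    using that[of a b] a b unfolding Dv_def by (simp add: algebra_simps)
qed

text \<open>
  The second difference is symmetric in \<open>v\<close> and \<open>w\<close>, so the two mixed derivatives agree at points
  that can be chosen as close to \<open>x\<close> as desired; both are continuous at \<open>x\<close>.
\<close>

lemma second_derivative_symmetric:
  fixes f :: "'a::real_normed_vector \<Rightarrow> real"
  assumes "open S" "smooth_on f S" "x \<in> S"
  shows "frechet_derivative (\<lambda>y. frechet_derivative f (at y) v) (at x) w =
    frechet_derivative (\<lambda>y. frechet_derivative f (at y) w) (at x) v"
proof -
  define P where "P v w = (\<lambda>y. frechet_derivative (\<lambda>y. frechet_derivative f (at y) v) (at y) w)" for v w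
  obtain r where r: "0 < r" "ball x r \<subseteq> S"
    using assms openE by blast
  \<comment> \<open>The parallelograms with sides \<open>s n *\<^sub>R v\<close> and \<open>s n *\<^sub>R w\<close> at \<open>x\<close> lie in the ball and shrink to \<open>x\<close>;
    the summand 1 keeps \<open>R\<close> positive when both directions vanish.\<close>
  define R where "R = norm v + norm w + 1"
  have R: "R > 0" "norm v + norm w < R" by (auto simp: R_def intro: add_nonneg_pos)
  define s where "s n = r / (R * (real n + 1))" for n
  have sR: "s n * R = r / (real n + 1)" for n
    using R by (simp add: s_def)
  have s: "s n > 0" "s n * R \<le> r" for n
    using r R unfolding sR by (simp_all add: s_def divide_le_eq mult_pos_pos)
  have near: "norm (a *\<^sub>R v + b *\<^sub>R w) < s n * R" if "0 \<le> a" "a \<le> s n" "0 \<le> b" "b \<le> s n" for a b n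
  proof -
    have "norm (a *\<^sub>R v + b *\<^sub>R w) \<le> a * norm v + b * norm w"
      using that by (metis abs_of_nonneg norm_scaleR norm_triangle_ineq)
    also have "\<dots> \<le> s n * (norm v + norm w)"
      using that by (simp add: distrib_left add_mono mult_right_mono)
    also have "\<dots> < s n * R"
      using R s by simp
    finally show ?thesis .
  qed
  have inS: "x + a *\<^sub>R v + b *\<^sub>R w \<in> S" if "0 \<le> a" "a \<le> s n" "0 \<le> b" "b \<le> s n" for a b n
  proof -
    have "norm (a *\<^sub>R v + b *\<^sub>R w) < r"
      using near[OF that] s(2)[of n] by linarith
    then have "x + (a *\<^sub>R v + b *\<^sub>R w) \<in> ball x r" by (simp add: dist_norm norm_minus_commute add.commute)
    then show ?thesis using r by (auto simp: add.assoc)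
  qed
  have "\<exists>y z. dist y x < s n * R \<and> dist z x < s n * R \<and> P v w y = P w v z" for n
  proof -
    obtain a b where ab: "0 < a" "a < s n" "0 < b" "b < s n"
      "f (x + s n *\<^sub>R v + s n *\<^sub>R w) - f (x + s n *\<^sub>R v) - f (x + s n *\<^sub>R w) + f x =
        s n * s n * P v w (x + a *\<^sub>R v + b *\<^sub>R w)"
      unfolding P_def by (rule second_difference_mvt[OF assms(2) s(1)[of n], of x v w]) (rule inS)
    have inS': "x + b *\<^sub>R w + a *\<^sub>R v \<in> S" if "0 \<le> b" "b \<le> s n" "0 \<le> a" "a \<le> s n" for a b
      using inS[of a n b] that by (simp add: algebra_simps)
    obtain c d where cd: "0 < c" "c < s n" "0 < d" "d < s n"
      "f (x + s n *\<^sub>R w + s n *\<^sub>R v) - f (x + s n *\<^sub>R w) - f (x + s n *\<^sub>R v) + f x =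
        s n * s n * P w v (x + c *\<^sub>R w + d *\<^sub>R v)"
      unfolding P_def by (rule second_difference_mvt[OF assms(2) s(1)[of n], of x w v]) (rule inS')
    have "f (x + s n *\<^sub>R w + s n *\<^sub>R v) = f (x + s n *\<^sub>R v + s n *\<^sub>R w)"
      by (simp add: algebra_simps)
    then have eq: "s n * s n * P v w (x + a *\<^sub>R v + b *\<^sub>R w) = s n * s n * P w v (x + c *\<^sub>R w + d *\<^sub>R v)"
      using ab(5) cd(5) by linarith
    have "s n * s n \<noteq> 0"
      using less_imp_neq[OF mult_pos_pos[OF s(1)[of n] s(1)[of n]]] by metis
    then have "P v w (x + a *\<^sub>R v + b *\<^sub>R w) = P w v (x + c *\<^sub>R w + d *\<^sub>R v)"
      using eq by (rule mult_left_cancel[THEN iffD1])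
    moreover have "dist (x + a *\<^sub>R v + b *\<^sub>R w) x < s n * R" "dist (x + c *\<^sub>R w + d *\<^sub>R v) x < s n * R"
      using near[of a n b] near[of d n c] ab cd by (simp_all add: dist_norm add.assoc add.commute[of "d *\<^sub>R v"])
    ultimately show ?thesis by blast
  qed
  then obtain Y Z where YZ: "\<And>n. dist (Y n) x < s n * R" "\<And>n. dist (Z n) x < s n * R"
      "\<And>n. P v w (Y n) = P w v (Z n)"
    by metis
  have lim0: "(\<lambda>n. s n * R) \<longlonglongrightarrow> 0"
  proof -
    have "(\<lambda>n. r * inverse (real (Suc n))) \<longlonglongrightarrow> r * 0"
      by (intro tendsto_mult tendsto_const LIMSEQ_inverse_real_of_nat)
    moreover have "(\<lambda>n. s n * R) = (\<lambda>n. r * inverse (real (Suc n)))"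
      unfolding sR by (simp add: divide_inverse add.commute)
    ultimately show ?thesis by simp
  qed
  have lim: "Y \<longlonglongrightarrow> x" "Z \<longlonglongrightarrow> x"
    using YZ by (auto intro!: metric_tendsto_imp_tendsto[OF lim0] eventuallyI simp: less_imp_le abs_of_pos s R)
  have "isCont (P a b) x" for a b
    unfolding P_def using assms
    by (metis continuous_on_eq_continuous_at smooth_on_continuous_on smooth_on_derivative)
  then have "(\<lambda>n. P v w (Y n)) \<longlonglongrightarrow> P v w x" "(\<lambda>n. P w v (Z n)) \<longlonglongrightarrow> P w v x"
    using lim isCont_tendsto_compose by blast+
  then have "P v w x = P w v x"
    using YZ(3) LIMSEQ_unique by auto
  then show ?thesis by (simp add: P_def)
qed

section \<open>Atlases and smooth maps\<close>

definition is_chart :: "'m::topological_space set \<Rightarrow> ('m \<Rightarrow> 'e::real_inner) \<Rightarrow> bool" where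
  "is_chart U \<phi> \<longleftrightarrow>
     open U \<and> open (\<phi> ` U) \<and> inj_on \<phi> U \<and> homeomorphism U (\<phi> ` U) \<phi> (the_inv_into U \<phi>)"

lemma is_chart_iff:
  "is_chart U \<phi> \<longleftrightarrow> open U \<and> open (\<phi> ` U) \<and> inj_on \<phi> U \<and> continuous_on U \<phi> \<and>
     continuous_on (\<phi> ` U) (the_inv_into U \<phi>)"
  by (auto simp: is_chart_def homeomorphism_def the_inv_into_f_f the_inv_into_onto)

lemma is_chart_inv:
  assumes "is_chart U \<phi>"
  shows "p \<in> U \<Longrightarrow> the_inv_into U \<phi> (\<phi> p) = p"
    and "s \<in> \<phi> ` U \<Longrightarrow> \<phi> (the_inv_into U \<phi> s) = s"
    and "s \<in> \<phi> ` U \<Longrightarrow> the_inv_into U \<phi> s \<in> U"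
  using assms by (auto simp: is_chart_iff the_inv_into_f_f)

lemma is_chart_image_Int:
  assumes "is_chart U \<phi>"
  shows "\<phi> ` (U \<inter> W) = {s \<in> \<phi> ` U. the_inv_into U \<phi> s \<in> W}"
  using is_chart_inv[OF assms] by (auto simp: image_iff)

lemma is_chart_open_image:
  assumes "is_chart U \<phi>" "open W"
  shows "open (\<phi> ` (U \<inter> W))"
proof -
  have "\<phi> ` (U \<inter> W) = the_inv_into U \<phi> -` W \<inter> \<phi> ` U"
    unfolding is_chart_image_Int[OF assms(1)] by auto
  then show ?thesis
    using assms continuous_on_open_vimage[of "\<phi> ` U" "the_inv_into U \<phi>"] by (auto simp: is_chart_iff)
qed

lemma the_inv_into_map_prod:
  assumes "inj_on \<phi> U" "inj_on \<psi> V" "s \<in> \<phi> ` U" "t \<in> \<psi> ` V"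
  shows "the_inv_into (U \<times> V) (map_prod \<phi> \<psi>) (s, t) = (the_inv_into U \<phi> s, the_inv_into V \<psi> t)"
proof -
  obtain x y where "x \<in> U" "y \<in> V" "s = \<phi> x" "t = \<psi> y"
    using assms by auto
  then show ?thesis
    using the_inv_into_f_f[OF map_prod_inj_on[OF assms(1,2)], of "(x, y)"] assms
    by (simp add: the_inv_into_f_f)
qed

lemma the_inv_into_id: "the_inv_into UNIV id = id"
  using the_inv_into_f_f[of id UNIV] by (intro ext) auto

lemma map_prod_image_Times: "map_prod f g ` (U \<times> V) = f ` U \<times> g ` V"
  by auto

lemma continuous_on_Times_map:
  assumes "continuous_on U f" "continuous_on V g"
  shows "continuous_on (U \<times> V) (\<lambda>p. (f (fst p), g (snd p)))"
proof (rule continuous_on_Pair)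
  show "continuous_on (U \<times> V) (\<lambda>p. f (fst p))"
    by (rule continuous_on_compose2[OF assms(1) continuous_on_fst[OF continuous_on_id]]) auto
  show "continuous_on (U \<times> V) (\<lambda>p. g (snd p))"
    by (rule continuous_on_compose2[OF assms(2) continuous_on_snd[OF continuous_on_id]]) auto
qed

lemma is_chart_prod:
  assumes "is_chart U \<phi>" "is_chart V \<psi>"
  shows "is_chart (U \<times> V) (map_prod \<phi> \<psi>)"
proof -
  have inj: "inj_on \<phi> U" "inj_on \<psi> V" using assms by (auto simp: is_chart_iff)
  have "continuous_on (U \<times> V) (\<lambda>p. (\<phi> (fst p), \<psi> (snd p)))"
    using assms unfolding is_chart_iff by (intro continuous_on_Times_map) auto
  then have c1: "continuous_on (U \<times> V) (map_prod \<phi> \<psi>)"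
    by (rule continuous_on_cong[THEN iffD1, rotated -1]) auto
  have "continuous_on (\<phi> ` U \<times> \<psi> ` V) (\<lambda>p. (the_inv_into U \<phi> (fst p), the_inv_into V \<psi> (snd p)))"
    using assms unfolding is_chart_iff by (intro continuous_on_Times_map) auto
  then have c2: "continuous_on (\<phi> ` U \<times> \<psi> ` V) (the_inv_into (U \<times> V) (map_prod \<phi> \<psi>))"
    by (rule continuous_on_cong[THEN iffD1, rotated -1])
      (auto simp: the_inv_into_map_prod[OF inj])
  show ?thesis
    using assms c1 c2 map_prod_inj_on[OF inj]
    unfolding is_chart_iff map_prod_image_Times by (auto intro: open_Times)
qed

text \<open>
  The axioms of \<^locale>\<open>smooth_manifold\<close> without its requirements on the type of points.  The
  cotangent bundle \<open>K \<times> Lie(K)\<close> is to be an instance, and a type of class \<^class>\<open>real_inner\<close> is not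
  known to be second countable.
\<close>

locale smooth_atlas =
  fixes A :: "('m::topological_space, 'e::real_inner) atlas"
  assumes finite_dim: "finite_dimensional TYPE('e)"
    and chart: "(U, \<phi>) \<in> A \<Longrightarrow> is_chart U \<phi>"
    and cover: "\<exists>(U, \<phi>)\<in>A. p \<in> U"
    and transition: "(U, \<phi>) \<in> A \<Longrightarrow> (V, \<psi>) \<in> A \<Longrightarrow>
      smooth_on (\<psi> \<circ> the_inv_into U \<phi>) (\<phi> ` (U \<inter> V))"
begin

lemma chart_at: obtains U \<phi> where "(U, \<phi>) \<in> A" "p \<in> U"
  using cover[of p] by auto

lemma open_chart: "(U, \<phi>) \<in> A \<Longrightarrow> open U" "(U, \<phi>) \<in> A \<Longrightarrow> open (\<phi> ` U)"
  using chart[of U \<phi>] by (auto simp: is_chart_iff)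

lemma inj_chart: "(U, \<phi>) \<in> A \<Longrightarrow> inj_on \<phi> U"
  using chart[of U \<phi>] by (auto simp: is_chart_iff)

end

lemma (in smooth_manifold) smooth_atlas: "smooth_atlas A"
  using finite_dim chart cover transition
  by unfold_locales (auto simp: finite_dimensional_def is_chart_def)

lemma smooth_atlas_id:
  "finite_dimensional TYPE('a::real_inner) \<Longrightarrow> smooth_atlas {(UNIV, id :: 'a \<Rightarrow> 'a)}"
  using smooth_on_ident[OF open_UNIV, where 'a = 'a]
  by unfold_locales
    (auto simp: is_chart_iff the_inv_into_id comp_id id_def[symmetric] continuous_on_id)

lemma prod_atlasI: "(U, \<phi>) \<in> A \<Longrightarrow> (V, \<psi>) \<in> B \<Longrightarrow> (U \<times> V, map_prod \<phi> \<psi>) \<in> prod_atlas A B"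
  by (auto simp: prod_atlas_def)

lemma prod_atlasE:
  assumes "(W, \<xi>) \<in> prod_atlas A B"
  obtains U \<phi> V \<psi> where "(U, \<phi>) \<in> A" "(V, \<psi>) \<in> B" "W = U \<times> V" "\<xi> = map_prod \<phi> \<psi>"
  using assms by (auto simp: prod_atlas_def)

lemma smooth_atlas_prod:
  assumes "smooth_atlas (A :: ('m::topological_space, 'e::real_inner) atlas)"
    and "smooth_atlas (B :: ('n::topological_space, 'f::real_inner) atlas)"
  shows "smooth_atlas (prod_atlas A B)"
proof -
  interpret A: smooth_atlas A by fact
  interpret B: smooth_atlas B by fact
  show ?thesis
  proof
    show "finite_dimensional TYPE('e \<times> 'f)"
      using A.finite_dim B.finite_dim by (rule finite_dimensional_prod)
  next
    fix W \<xi> assume "(W, \<xi>) \<in> prod_atlas A B"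
    then show "is_chart W \<xi>"
      by (auto elim!: prod_atlasE intro!: is_chart_prod A.chart B.chart)
  next
    fix p :: "'m \<times> 'n"
    obtain U \<phi> where 1: "(U, \<phi>) \<in> A" "fst p \<in> U" by (rule A.chart_at)
    obtain V \<psi> where 2: "(V, \<psi>) \<in> B" "snd p \<in> V" by (rule B.chart_at)
    show "\<exists>(W, \<xi>)\<in>prod_atlas A B. p \<in> W"
      using prod_atlasI[OF 1(1) 2(1)] 1(2) 2(2) 
      by (intro bexI[of _ "(U \<times> V, map_prod \<phi> \<psi>)"]) (auto simp: mem_Times_iff)
  next
    fix W \<xi> W' \<xi>' assume W: "(W, \<xi>) \<in> prod_atlas A B" and W': "(W', \<xi>') \<in> prod_atlas A B"
    obtain U \<phi> V \<psi> where 1: "(U, \<phi>) \<in> A" "(V, \<psi>) \<in> B" "W = U \<times> V" "\<xi> = map_prod \<phi> \<psi>"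
      using W by (rule prod_atlasE)
    obtain U' \<phi>' V' \<psi>' where 2: "(U', \<phi>') \<in> A" "(V', \<psi>') \<in> B" "W' = U' \<times> V'" "\<xi>' = map_prod \<phi>' \<psi>'"
      using W' by (rule prod_atlasE)
    let ?S = "\<phi> ` (U \<inter> U')" and ?T = "\<psi> ` (V \<inter> V')"
    have op: "open ?S" "open ?T"
      using 1 2 A.chart B.chart A.open_chart B.open_chart is_chart_open_image by blast+
    note ST = open_Times[OF op]
    have "smooth_on (\<lambda>z. (\<phi>' (the_inv_into U \<phi> (fst z)), \<psi>' (the_inv_into V \<psi> (snd z)))) (?S \<times> ?T)"
    proof (rule smooth_on_Pair[OF ST])
      show "smooth_on (\<lambda>z. \<phi>' (the_inv_into U \<phi> (fst z))) (?S \<times> ?T)"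
        using smooth_on_compose[OF A.finite_dim ST smooth_on_fst[OF ST] A.transition[OF 1(1) 2(1)]]
        by (simp add: image_subset_iff)
      show "smooth_on (\<lambda>z. \<psi>' (the_inv_into V \<psi> (snd z))) (?S \<times> ?T)"
        using smooth_on_compose[OF B.finite_dim ST smooth_on_snd[OF ST] B.transition[OF 1(2) 2(2)]]
        by (simp add: image_subset_iff)
    qed
    moreover have "\<xi> ` (W \<inter> W') = ?S \<times> ?T"
      unfolding 1(3,4) 2(3,4) Times_Int_Times map_prod_image_Times ..
    moreover have "(\<phi>' (the_inv_into U \<phi> (fst z)), \<psi>' (the_inv_into V \<psi> (snd z))) = (\<xi>' \<circ> the_inv_into W \<xi>) z"
      if "z \<in> ?S \<times> ?T" for z
    proof -
      have "fst z \<in> \<phi> ` U" "snd z \<in> \<psi> ` V" using that by auto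
      then have "the_inv_into W \<xi> (fst z, snd z) = (the_inv_into U \<phi> (fst z), the_inv_into V \<psi> (snd z))"
        unfolding 1(3,4) by (rule the_inv_into_map_prod[OF A.inj_chart[OF 1(1)] B.inj_chart[OF 1(2)]])
      then show ?thesis by (simp add: 2(4))
    qed
    ultimately show "smooth_on (\<xi>' \<circ> the_inv_into W \<xi>) (\<xi> ` (W \<inter> W'))"
      using smooth_on_cong[OF ST, where g = "\<xi>' \<circ> the_inv_into W \<xi>"] by presburger
  qed
qed

lemma smooth_mapD:
  "smooth_map A B F \<Longrightarrow> (U, \<phi>) \<in> A \<Longrightarrow> (V, \<psi>) \<in> B \<Longrightarrow>
    smooth_on (\<lambda>s. \<psi> (F (the_inv_into U \<phi> s))) (\<phi> ` (U \<inter> F -` V))"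
  by (auto simp: smooth_map_def o_def)

lemma smooth_map_continuous: "smooth_map A B F \<Longrightarrow> continuous_on UNIV F"
  by (simp add: smooth_map_def)

lemma smooth_mapI:
  assumes "continuous_on UNIV F"
    and "\<And>U \<phi> V \<psi>. (U, \<phi>) \<in> A \<Longrightarrow> (V, \<psi>) \<in> B \<Longrightarrow>
      smooth_on (\<lambda>s. \<psi> (F (the_inv_into U \<phi> s))) (\<phi> ` (U \<inter> F -` V))"
  shows "smooth_map A B F"
  using assms by (auto simp: smooth_map_def o_def)

text \<open>
  Smoothness being local, it is enough to look at points that a single chart of the space in the
  middle covers.
\<close>

lemma smooth_map_compose:
  fixes A :: "('m::topological_space, 'e::real_inner) atlas"
    and B :: "('n::topological_space, 'f::real_inner) atlas"
    and C :: "('o::topological_space, 'g::real_inner) atlas"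
  assumes "smooth_atlas A" "smooth_atlas B" "smooth_atlas C" and F: "smooth_map A B F" and G: "smooth_map B C G"
  shows "smooth_map A C (\<lambda>x. G (F x))"
proof (rule smooth_mapI)
  interpret A: smooth_atlas A by fact
  interpret B: smooth_atlas B by fact
  interpret C: smooth_atlas C by fact
  show "continuous_on UNIV (\<lambda>x. G (F x))"
    using smooth_map_continuous[OF F] smooth_map_continuous[OF G] continuous_on_compose2 by blast
  have open_vimage: "open (F -` V)" if "open V" for V
    using smooth_map_continuous[OF F] that by (simp add: continuous_on_open_vimage open_vimage)
  have open_vimage': "open (G -` V)" if "open V" for V
    using smooth_map_continuous[OF G] that by (simp add: continuous_on_open_vimage open_vimage)
  fix U \<phi> W \<xi> assume U: "(U, \<phi>) \<in> A" and W: "(W, \<xi>) \<in> C"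
  show "smooth_on (\<lambda>s. \<xi> (G (F (the_inv_into U \<phi> s)))) (\<phi> ` (U \<inter> (\<lambda>x. G (F x)) -` W))"
  proof (rule smooth_on_local)
    fix s assume s: "s \<in> \<phi> ` (U \<inter> (\<lambda>x. G (F x)) -` W)"
    obtain V \<psi> where V: "(V, \<psi>) \<in> B" "F (the_inv_into U \<phi> s) \<in> V"
      by (rule B.chart_at)
    let ?T = "\<phi> ` (U \<inter> (F -` V \<inter> F -` G -` W))"
    have T: "open ?T"
      using is_chart_open_image[OF A.chart[OF U], of "F -` V \<inter> F -` G -` W"]
        open_vimage open_vimage' B.open_chart[OF V(1)] C.open_chart[OF W] by auto
    have "s \<in> ?T"
      using s V by (auto simp: is_chart_inv[OF A.chart[OF U]])
    moreover have "smooth_on (\<lambda>s. \<xi> (G (F (the_inv_into U \<phi> s)))) ?T"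
    proof (rule smooth_on_cong[OF T])
      show "smooth_on (\<lambda>s. \<xi> (G (the_inv_into V \<psi> (\<psi> (F (the_inv_into U \<phi> s)))))) ?T"
        by (rule smooth_on_compose[OF B.finite_dim T smooth_on_subset[OF smooth_mapD[OF F U V(1)]] smooth_mapD[OF G V(1) W]])
          (auto simp: is_chart_inv[OF A.chart[OF U]])
      show "\<xi> (G (the_inv_into V \<psi> (\<psi> (F (the_inv_into U \<phi> s))))) = \<xi> (G (F (the_inv_into U \<phi> s)))" if "s \<in> ?T" for s
        using that by (auto simp: is_chart_inv[OF A.chart[OF U]] is_chart_inv[OF B.chart[OF V(1)]])
    qed
    ultimately show "\<exists>T. open T \<and> s \<in> T \<and> smooth_on (\<lambda>s. \<xi> (G (F (the_inv_into U \<phi> s)))) T"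
      using T by blast
  qed
qed

lemma smooth_map_id:
  "smooth_atlas A \<Longrightarrow> smooth_map A A (\<lambda>x. x)"
  using smooth_atlas.transition by (intro smooth_mapI) (fastforce simp: o_def)+

lemma smooth_map_const: "smooth_map A B (\<lambda>x. c)"
  by (intro smooth_mapI) auto

lemma smooth_map_Pair:
  fixes A :: "('m::topological_space, 'e::real_inner) atlas"
    and B :: "('n::topological_space, 'f::real_inner) atlas"
    and C :: "('o::topological_space, 'g::real_inner) atlas"
  assumes "smooth_atlas A" "smooth_atlas B" "smooth_atlas C" and F: "smooth_map A B F" and G: "smooth_map A C G"
  shows "smooth_map A (prod_atlas B C) (\<lambda>x. (F x, G x))"
proof (rule smooth_mapI)
  interpret A: smooth_atlas A by fact
  interpret B: smooth_atlas B by fact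
  interpret C: smooth_atlas C by fact
  show "continuous_on UNIV (\<lambda>x. (F x, G x))"
    using F G by (intro continuous_on_Pair smooth_map_continuous)
  have open_vimage: "open (F -` V)" if "open V" for V
    using smooth_map_continuous[OF F] that by (simp add: continuous_on_open_vimage open_vimage)
  have open_vimage': "open (G -` V)" if "open V" for V
    using smooth_map_continuous[OF G] that by (simp add: continuous_on_open_vimage open_vimage)
  fix U \<phi> W \<xi> assume U: "(U, \<phi>) \<in> A" and W: "(W, \<xi>) \<in> prod_atlas B C"
  obtain V \<psi> V' \<psi>' where V: "(V, \<psi>) \<in> B" "(V', \<psi>') \<in> C" "W = V \<times> V'" "\<xi> = map_prod \<psi> \<psi>'"
    using W by (rule prod_atlasE)
  let ?S = "\<phi> ` (U \<inter> (\<lambda>x. (F x, G x)) -` W)"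
  have eq: "?S = \<phi> ` (U \<inter> (F -` V \<inter> G -` V'))" using V by auto
  have S: "open ?S"
    unfolding eq using is_chart_open_image[OF A.chart[OF U], of "F -` V \<inter> G -` V'"]
        open_vimage open_vimage' B.open_chart[OF V(1)] C.open_chart[OF V(2)] by auto
  have "smooth_on (\<lambda>s. (\<psi> (F (the_inv_into U \<phi> s)), \<psi>' (G (the_inv_into U \<phi> s)))) ?S"
    by (intro smooth_on_Pair S smooth_on_subset[OF smooth_mapD[OF F U V(1)]] smooth_on_subset[OF smooth_mapD[OF G U V(2)]])
      (auto simp: V)
  then show "smooth_on (\<lambda>s. \<xi> (F (the_inv_into U \<phi> s), G (the_inv_into U \<phi> s))) ?S"
    by (simp add: V)
qed

lemma smooth_map_fst:
  fixes A :: "('m::topological_space, 'e::real_inner) atlas"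
    and B :: "('n::topological_space, 'f::real_inner) atlas"
  assumes "smooth_atlas A" "smooth_atlas B"
  shows "smooth_map (prod_atlas A B) A fst"
proof (rule smooth_mapI)
  interpret A: smooth_atlas A by fact
  interpret B: smooth_atlas B by fact
  show "continuous_on UNIV (fst :: 'm \<times> 'n \<Rightarrow> 'm)" by (intro continuous_intros)
  fix W \<xi> U' \<phi>' assume W: "(W, \<xi>) \<in> prod_atlas A B" and U': "(U', \<phi>') \<in> A"
  obtain U \<phi> V \<psi> where V: "(U, \<phi>) \<in> A" "(V, \<psi>) \<in> B" "W = U \<times> V" "\<xi> = map_prod \<phi> \<psi>"
    using W by (rule prod_atlasE)
  have eq: "\<xi> ` (W \<inter> fst -` U') = \<phi> ` (U \<inter> U') \<times> \<psi> ` V" 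
  proof -
    have "W \<inter> fst -` U' = (U \<inter> U') \<times> V" using V(3) by auto
    then show ?thesis by (simp only: V(4) map_prod_image_Times)
  qed
  have S: "open (\<phi> ` (U \<inter> U') \<times> \<psi> ` V)"
    using is_chart_open_image[OF A.chart[OF V(1)]] A.open_chart[OF U'] B.open_chart[OF V(2)] by (auto intro: open_Times)
  show "smooth_on (\<lambda>s. \<phi>' (fst (the_inv_into W \<xi> s))) (\<xi> ` (W \<inter> fst -` U'))"
    unfolding eq
  proof (rule smooth_on_cong[OF S])
    show "smooth_on (\<lambda>s. (\<phi>' \<circ> the_inv_into U \<phi>) (fst s)) (\<phi> ` (U \<inter> U') \<times> \<psi> ` V)"
      by (rule smooth_on_compose[OF A.finite_dim S smooth_on_fst[OF S] A.transition[OF V(1) U']]) auto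
    show "(\<phi>' \<circ> the_inv_into U \<phi>) (fst s) = \<phi>' (fst (the_inv_into W \<xi> s))" if "s \<in> \<phi> ` (U \<inter> U') \<times> \<psi> ` V" for s
      using that by (auto simp: V(3,4) the_inv_into_map_prod[OF A.inj_chart[OF V(1)] B.inj_chart[OF V(2)]])
  qed
qed

lemma smooth_map_snd:
  fixes A :: "('m::topological_space, 'e::real_inner) atlas"
    and B :: "('n::topological_space, 'f::real_inner) atlas"
  assumes "smooth_atlas A" "smooth_atlas B"
  shows "smooth_map (prod_atlas A B) B snd"
proof (rule smooth_mapI)
  interpret A: smooth_atlas A by fact
  interpret B: smooth_atlas B by fact
  show "continuous_on UNIV (snd :: 'm \<times> 'n \<Rightarrow> 'n)" by (intro continuous_intros)
  fix W \<xi> V' \<psi>' assume W: "(W, \<xi>) \<in> prod_atlas A B" and V': "(V', \<psi>') \<in> B"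
  obtain U \<phi> V \<psi> where V: "(U, \<phi>) \<in> A" "(V, \<psi>) \<in> B" "W = U \<times> V" "\<xi> = map_prod \<phi> \<psi>"
    using W by (rule prod_atlasE)
  have eq: "\<xi> ` (W \<inter> snd -` V') = \<phi> ` U \<times> \<psi> ` (V \<inter> V')" 
  proof -
    have "W \<inter> snd -` V' = U \<times> (V \<inter> V')" using V(3) by auto
    then show ?thesis by (simp only: V(4) map_prod_image_Times)
  qed
  have S: "open (\<phi> ` U \<times> \<psi> ` (V \<inter> V'))"
    using is_chart_open_image[OF B.chart[OF V(2)]] B.open_chart[OF V'] A.open_chart[OF V(1)] by (auto intro: open_Times)
  show "smooth_on (\<lambda>s. \<psi>' (snd (the_inv_into W \<xi> s))) (\<xi> ` (W \<inter> snd -` V'))"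
    unfolding eq
  proof (rule smooth_on_cong[OF S])
    show "smooth_on (\<lambda>s. (\<psi>' \<circ> the_inv_into V \<psi>) (snd s)) (\<phi> ` U \<times> \<psi> ` (V \<inter> V'))"
      by (rule smooth_on_compose[OF B.finite_dim S smooth_on_snd[OF S] B.transition[OF V(2) V']]) auto
    show "(\<psi>' \<circ> the_inv_into V \<psi>) (snd s) = \<psi>' (snd (the_inv_into W \<xi> s))" if "s \<in> \<phi> ` U \<times> \<psi> ` (V \<inter> V')" for s
      using that by (auto simp: V(3,4) the_inv_into_map_prod[OF A.inj_chart[OF V(1)] B.inj_chart[OF V(2)]])
  qed
qed

text \<open>
  A function that is smooth in all charts is continuous because the charts cover.  This transfers
  the closure properties of smooth maps to functions.
\<close>

lemma smooth_fun_iff_smooth_map: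
  fixes f :: "'m::topological_space \<Rightarrow> real"
  assumes "smooth_atlas A"
  shows "smooth_fun A f \<longleftrightarrow> smooth_map A {(UNIV, id)} f"
proof
  interpret A: smooth_atlas A by fact
  assume f: "smooth_fun A f"
  show "smooth_map A {(UNIV, id)} f"
  proof (rule smooth_mapI)
    have "continuous_on U f" if U: "U \<in> fst ` A" for U
    proof -
      obtain \<phi> where U: "(U, \<phi>) \<in> A" using U by auto
      have c: "continuous_on (\<phi> ` U) (f \<circ> the_inv_into U \<phi>)"
        using f U by (intro smooth_on_continuous_on) (auto simp: smooth_fun_def)
      have "continuous_on U (\<lambda>p. (f \<circ> the_inv_into U \<phi>) (\<phi> p))"
        using A.chart[OF U] by (intro continuous_on_compose2[OF c]) (auto simp: is_chart_iff)
      then show ?thesis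
        by (rule continuous_on_cong[THEN iffD1, rotated -1]) (auto simp: is_chart_inv[OF A.chart[OF U]])
    qed
    moreover have "open U" if "U \<in> fst ` A" for U
      using that A.open_chart by auto
    moreover have "\<Union>(fst ` A) = UNIV"
      using A.cover by fastforce
    ultimately show "continuous_on UNIV f"
      by (metis continuous_on_open_Union)
  qed (use f in \<open>auto simp: smooth_fun_def o_def\<close>)
next
  assume "smooth_map A {(UNIV, id)} f"
  then show "smooth_fun A f"
    by (auto simp: smooth_map_def smooth_fun_def o_def)
qed

lemma smooth_atlas_real: "smooth_atlas {(UNIV, id :: real \<Rightarrow> real)}"
proof (rule smooth_atlas_id)
  have "finite {1::real}" "span {1::real} = UNIV"
    by (auto simp: span_singleton intro!: image_eqI[of _ _ "_::real"])
  then show "finite_dimensional TYPE(real)" unfolding finite_dimensional_def by blast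
qed

lemma smooth_fun_compose:
  fixes A :: "('m::topological_space, 'e::real_inner) atlas"
    and B :: "('n::topological_space, 'f::real_inner) atlas"
  assumes "smooth_atlas A" "smooth_atlas B" "smooth_map A B F" "smooth_fun B f"
  shows "smooth_fun A (\<lambda>x. f (F x))"
  using smooth_map_compose[OF assms(1,2) smooth_atlas_real assms(3)] assms
  by (simp add: smooth_fun_iff_smooth_map)

lemma smooth_funD: "smooth_fun A f \<Longrightarrow> (U, \<phi>) \<in> A \<Longrightarrow> smooth_on (\<lambda>s. f (the_inv_into U \<phi> s)) (\<phi> ` U)"
  by (auto simp: smooth_fun_def o_def)

lemma smooth_fun_const [simp]: "smooth_fun A (\<lambda>x. c)"
  by (auto simp: smooth_fun_def o_def)

context smooth_atlas
begin

lemma smooth_fun_add: "smooth_fun A f \<Longrightarrow> smooth_fun A g \<Longrightarrow> smooth_fun A (\<lambda>x. f x + g x)"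
  using open_chart by (fastforce simp: smooth_fun_def o_def intro: smooth_on_add)

lemma smooth_fun_mult: "smooth_fun A f \<Longrightarrow> smooth_fun A g \<Longrightarrow> smooth_fun A (\<lambda>x. f x * g x)"
  using open_chart by (fastforce simp: smooth_fun_def o_def intro: smooth_on_mult)

lemma smooth_fun_sum:
  "finite I \<Longrightarrow> (\<And>i. i \<in> I \<Longrightarrow> smooth_fun A (f i)) \<Longrightarrow> smooth_fun A (\<lambda>x. \<Sum>i\<in>I. f i x)"
  by (induction I rule: finite_induct) (auto intro: smooth_fun_add)

end

section \<open>Tangent vectors\<close>

lemma tvec_of_smooth:
  "smooth_fun A f \<Longrightarrow> tvec_of A (U, \<phi>) p v f = frechet_derivative (\<lambda>s. f (the_inv_into U \<phi> s)) (at (\<phi> p)) v"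
  by (simp add: tvec_of_def o_def)

lemma tvec_of_not_smooth: "\<not> smooth_fun A f \<Longrightarrow> tvec_of A c p v f = 0"
  by (simp add: tvec_of_def)

lemma tangent_space_not_smooth: "v \<in> tangent_space A p \<Longrightarrow> \<not> smooth_fun A f \<Longrightarrow> v f = 0"
  by (auto simp: tangent_space_def tvec_of_not_smooth)

lemma pushforward_smooth: "smooth_fun B f \<Longrightarrow> pushforward A B F v f = v (\<lambda>x. f (F x))"
  by (simp add: pushforward_def o_def)

lemma pushforward_not_smooth: "\<not> smooth_fun B f \<Longrightarrow> pushforward A B F v f = 0"
  by (simp add: pushforward_def)

lemma section_derivative:
  assumes "smooth_on G W" "(s, t) \<in> W"
  shows "frechet_derivative (\<lambda>z. G (s, z)) (at t) w = frechet_derivative G (at (s, t)) (0, w)"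
    and "frechet_derivative (\<lambda>z. G (z, t)) (at s) v = frechet_derivative G (at (s, t)) (v, 0)"
proof -
  have G: "(G has_derivative frechet_derivative G (at (s, t))) (at (s, t))"
    using assms by (intro smooth_on_has_derivative) auto
  have 1: "((\<lambda>z. (s, z)) has_derivative (\<lambda>w. (0, w))) (at t)"
    and 2: "((\<lambda>z. (z, t)) has_derivative (\<lambda>v. (v, 0))) (at s)"
    by (auto intro!: derivative_eq_intros)
  show "frechet_derivative (\<lambda>z. G (s, z)) (at t) w = frechet_derivative G (at (s, t)) (0, w)"
    using frechet_derivative_at[OF diff_chain_at[OF 1 G]] by (simp add: o_def fun_eq_iff)
  show "frechet_derivative (\<lambda>z. G (z, t)) (at s) v = frechet_derivative G (at (s, t)) (v, 0)"
    using frechet_derivative_at[OF diff_chain_at[OF 2 G]] by (simp add: o_def fun_eq_iff)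
qed

lemma frechet_derivative_cong_open:
  assumes "smooth_on f S" "open S" "s \<in> S" "\<And>x. x \<in> S \<Longrightarrow> f x = g x"
  shows "frechet_derivative g (at s) = frechet_derivative f (at s)"
  using frechet_derivative_transform_within_open[of f s S g] assms smooth_on_has_derivative
  by (metis differentiable_def)

context smooth_atlas
begin

lemma chart_has_derivative:
  assumes "smooth_fun A f" "(U, \<phi>) \<in> A" "p \<in> U"
  shows "((\<lambda>s. f (the_inv_into U \<phi> s)) has_derivative (\<lambda>v. tvec_of A (U, \<phi>) p v f)) (at (\<phi> p))"
  using smooth_on_has_derivative[OF smooth_funD[OF assms(1,2)], of "\<phi> p"] assms
  by (simp add: tvec_of_smooth)

lemma tvec_of_linear:
  assumes "(U, \<phi>) \<in> A" "p \<in> U"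
  shows "linear (\<lambda>v. tvec_of A (U, \<phi>) p v f)"
proof (cases "smooth_fun A f")
  case True
  then show ?thesis using has_derivative_linear[OF chart_has_derivative[OF True assms]] by simp
next
  case False
  then show ?thesis by (simp add: tvec_of_not_smooth linear_zero)
qed

lemma tangent_add:
  assumes v: "v \<in> tangent_space A p" and f: "smooth_fun A f" and g: "smooth_fun A g"
  shows "v (\<lambda>x. f x + g x) = v f + v g"
proof -
  obtain U \<phi> w where U: "(U, \<phi>) \<in> A" "p \<in> U" "v = tvec_of A (U, \<phi>) p w"
    using v by (auto simp: tangent_space_def)
  show ?thesis
    using frechet_derivative_at[OF has_derivative_add[OF chart_has_derivative[OF f U(1,2)] chart_has_derivative[OF g U(1,2)]]]
    by (simp add: U(3) tvec_of_smooth[OF smooth_fun_add[OF f g]] fun_eq_iff)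
qed

lemma tangent_mult:
  assumes v: "v \<in> tangent_space A p" and f: "smooth_fun A f" and g: "smooth_fun A g"
  shows "v (\<lambda>x. f x * g x) = f p * v g + v f * g p"
proof -
  obtain U \<phi> w where U: "(U, \<phi>) \<in> A" "p \<in> U" "v = tvec_of A (U, \<phi>) p w"
    using v by (auto simp: tangent_space_def)
  show ?thesis
    using frechet_derivative_at[OF has_derivative_mult[OF chart_has_derivative[OF f U(1,2)] chart_has_derivative[OF g U(1,2)]]]
    by (simp add: U(3) tvec_of_smooth[OF smooth_fun_mult[OF f g]] is_chart_inv[OF chart[OF U(1)]] U(2) fun_eq_iff)
qed

lemma tangent_const:
  assumes v: "v \<in> tangent_space A p"
  shows "v (\<lambda>x. c) = 0"
  using v by (auto simp: tangent_space_def tvec_of_smooth)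

lemma tangent_cmult:
  assumes v: "v \<in> tangent_space A p" and f: "smooth_fun A f"
  shows "v (\<lambda>x. c * f x) = c * v f"
  using tangent_mult[OF v smooth_fun_const[of A c] f] tangent_const[OF v] by simp

lemma tangent_sum:
  assumes v: "v \<in> tangent_space A p" and "finite I" "\<And>i. i \<in> I \<Longrightarrow> smooth_fun A (f i)"
  shows "v (\<lambda>x. \<Sum>i\<in>I. f i x) = (\<Sum>i\<in>I. v (f i))"
  using assms(2,3)
  by (induction I rule: finite_induct) (simp_all add: tangent_const[OF v] tangent_add[OF v] smooth_fun_sum)

lemma smooth_fun_comp_vector:
  fixes h :: "'g::real_inner \<Rightarrow> real"
  assumes g: "finite_dimensional TYPE('g)" and h: "smooth_on h UNIV"
    and r: "finite I" "\<And>i. i \<in> I \<Longrightarrow> smooth_fun A (r i)"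
  shows "smooth_fun A (\<lambda>x. h (\<Sum>i\<in>I. r i x *\<^sub>R e i))"
proof -
  have "smooth_on (\<lambda>s. h (\<Sum>i\<in>I. r i (the_inv_into U \<phi> s) *\<^sub>R e i)) (\<phi> ` U)" if U: "(U, \<phi>) \<in> A" for U \<phi>
  proof (rule smooth_on_compose[OF g open_chart(2)[OF U] _ h])
    show "smooth_on (\<lambda>s. \<Sum>i\<in>I. r i (the_inv_into U \<phi> s) *\<^sub>R e i) (\<phi> ` U)"
      using smooth_funD[OF r(2) U]
      by (intro smooth_on_sum[OF open_chart(2)[OF U] r(1)]
          smooth_on_linear_comp[OF open_chart(2)[OF U] bounded_linear_scaleR_left]) auto
  qed auto
  then show ?thesis by (auto simp: smooth_fun_def o_def)
qed

lemma tangent_chain: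
  fixes h :: "'g::real_inner \<Rightarrow> real"
  assumes v: "v \<in> tangent_space A p" and g: "finite_dimensional TYPE('g)" and h: "smooth_on h UNIV"
    and r: "finite I" "\<And>i. i \<in> I \<Longrightarrow> smooth_fun A (r i)"
  shows "v (\<lambda>x. h (\<Sum>i\<in>I. r i x *\<^sub>R e i)) =
    frechet_derivative h (at (\<Sum>i\<in>I. r i p *\<^sub>R e i)) (\<Sum>i\<in>I. v (r i) *\<^sub>R e i)"
proof -
  obtain U \<phi> w where U: "(U, \<phi>) \<in> A" "p \<in> U" "v = tvec_of A (U, \<phi>) p w"
    using v by (auto simp: tangent_space_def)
  let ?R = "\<lambda>s. \<Sum>i\<in>I. r i (the_inv_into U \<phi> s) *\<^sub>R e i"
  have R: "(?R has_derivative (\<lambda>v. \<Sum>i\<in>I. tvec_of A (U, \<phi>) p v (r i) *\<^sub>R e i)) (at (\<phi> p))"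
    by (intro has_derivative_sum has_derivative_scaleR_left chart_has_derivative r U(1,2))
  have "?R (\<phi> p) = (\<Sum>i\<in>I. r i p *\<^sub>R e i)"
    by (simp add: is_chart_inv[OF chart[OF U(1)]] U(2))
  then have "(h has_derivative frechet_derivative h (at (\<Sum>i\<in>I. r i p *\<^sub>R e i))) (at (?R (\<phi> p)))"
    using smooth_on_has_derivative[OF h UNIV_I] by simp
  from frechet_derivative_at[OF diff_chain_at[OF R this]] show ?thesis
    by (simp add: U(3) tvec_of_smooth[OF smooth_fun_comp_vector[OF g h r]] o_def fun_eq_iff)
qed

end

text \<open>
  The chain rule in charts.  For the identity map it is the rule for a change of chart, which shows
  that every chart around \<open>p\<close> represents all tangent vectors at \<open>p\<close>.
\<close>

lemma pushforward_tvec_of: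
  fixes A :: "('m::topological_space, 'e::real_inner) atlas"
    and B :: "('n::topological_space, 'f::real_inner) atlas"
  assumes A: "smooth_atlas A" and B: "smooth_atlas B" and F: "smooth_map A B F"
    and U: "(U, \<phi>) \<in> A" "p \<in> U" and V: "(V, \<psi>) \<in> B" "F p \<in> V"
  shows "pushforward A B F (tvec_of A (U, \<phi>) p v) =
    tvec_of B (V, \<psi>) (F p) (frechet_derivative (\<lambda>s. \<psi> (F (the_inv_into U \<phi> s))) (at (\<phi> p)) v)"
proof
  interpret A: smooth_atlas A by fact
  interpret B: smooth_atlas B by fact
  fix f
  show "pushforward A B F (tvec_of A (U, \<phi>) p v) f =
    tvec_of B (V, \<psi>) (F p) (frechet_derivative (\<lambda>s. \<psi> (F (the_inv_into U \<phi> s))) (at (\<phi> p)) v) f"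
  proof (cases "smooth_fun B f")
    case f: True
    let ?F = "\<lambda>s. \<psi> (F (the_inv_into U \<phi> s))" and ?f = "\<lambda>t. f (the_inv_into V \<psi> t)"
    let ?S = "\<phi> ` (U \<inter> F -` V)"
    have S: "open ?S"
      using is_chart_open_image[OF A.chart[OF U(1)], of "F -` V"] smooth_map_continuous[OF F]
        B.open_chart(1)[OF V(1)] by (simp add: continuous_on_open_vimage open_vimage)
    have pS: "\<phi> p \<in> ?S" using U V by auto
    have inv: "the_inv_into U \<phi> (\<phi> p) = p" using is_chart_inv[OF A.chart[OF U(1)]] U by auto
    have dF: "(?F has_derivative frechet_derivative ?F (at (\<phi> p))) (at (\<phi> p))"
      by (rule smooth_on_has_derivative[OF smooth_mapD[OF F U(1) V(1)] pS])
    have df: "(?f has_derivative frechet_derivative ?f (at (\<psi> (F p)))) (at (?F (\<phi> p)))"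
      using smooth_on_has_derivative[OF smooth_funD[OF f V(1)], of "\<psi> (F p)"] V(2) by (simp add: inv)
    have "((\<lambda>s. f (F (the_inv_into U \<phi> s))) has_derivative
        (frechet_derivative ?f (at (\<psi> (F p))) \<circ> frechet_derivative ?F (at (\<phi> p)))) (at (\<phi> p))"
      by (rule has_derivative_transform_within_open[OF diff_chain_at[OF dF df] S pS])
        (auto simp: is_chart_inv[OF A.chart[OF U(1)]] is_chart_inv[OF B.chart[OF V(1)]])
    from frechet_derivative_at[OF this] show ?thesis
      by (simp add: pushforward_smooth[OF f] tvec_of_smooth[OF f]
          tvec_of_smooth[OF smooth_fun_compose[OF A B F f]] fun_eq_iff o_def)
  qed (simp add: pushforward_not_smooth tvec_of_not_smooth)
qed

context smooth_atlas
begin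

lemma tangent_space_chart:
  assumes v: "v \<in> tangent_space A p" and V: "(V, \<psi>) \<in> A" "p \<in> V"
  obtains w where "v = tvec_of A (V, \<psi>) p w"
proof -
  obtain U \<phi> u where U: "(U, \<phi>) \<in> A" "p \<in> U" "v = tvec_of A (U, \<phi>) p u"
    using v by (auto simp: tangent_space_def)
  have "pushforward A A (\<lambda>x. x) v = v"
    by (auto simp: fun_eq_iff pushforward_def o_def tangent_space_not_smooth[OF v])
  then show thesis
    using pushforward_tvec_of[OF smooth_atlas_axioms smooth_atlas_axioms smooth_map_id[OF smooth_atlas_axioms] U(1,2) V] U(3) that
    by metis
qed

lemma tvec_of_in_tangent_space: "(U, \<phi>) \<in> A \<Longrightarrow> p \<in> U \<Longrightarrow> tvec_of A (U, \<phi>) p v \<in> tangent_space A p"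
  by (auto simp: tangent_space_def)

lemma vector_field_tangent: "vector_field A Z \<Longrightarrow> Z p \<in> tangent_space A p"
  by (rule chart_at[of p]) (fastforce simp: vector_field_def tangent_space_def)

end

lemma pushforward_tangent_space:
  assumes A: "smooth_atlas A" and B: "smooth_atlas B" and F: "smooth_map A B F" and v: "v \<in> tangent_space A p"
  shows "pushforward A B F v \<in> tangent_space B (F p)"
proof -
  obtain U \<phi> u where U: "(U, \<phi>) \<in> A" "p \<in> U" "v = tvec_of A (U, \<phi>) p u"
    using v by (auto simp: tangent_space_def)
  obtain V \<psi> where V: "(V, \<psi>) \<in> B" "F p \<in> V" using B by (rule smooth_atlas.chart_at)
  show ?thesis
    using pushforward_tvec_of[OF A B F U(1,2) V] smooth_atlas.tvec_of_in_tangent_space[OF B V] U(3) by simp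
qed

locale two_atlases = A: smooth_atlas A + B: smooth_atlas B
  for A :: "('m::topological_space, 'e::real_inner) atlas"
    and B :: "('n::topological_space, 'f::real_inner) atlas"
begin

lemma smooth_atlas_AB: "smooth_atlas (prod_atlas A B)"
  by (rule smooth_atlas_prod[OF A.smooth_atlas_axioms B.smooth_atlas_axioms])

lemma smooth_fun_chart_prod:
  assumes G: "smooth_fun (prod_atlas A B) G" and U: "(U, \<phi>) \<in> A" and V: "(V, \<psi>) \<in> B"
  shows "smooth_on (\<lambda>z. G (the_inv_into U \<phi> (fst z), the_inv_into V \<psi> (snd z))) (\<phi> ` U \<times> \<psi> ` V)"
proof (rule smooth_on_cong)
  show "open (\<phi> ` U \<times> \<psi> ` V)"
    by (intro open_Times A.open_chart[OF U] B.open_chart[OF V])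
  show "smooth_on (\<lambda>s. G (the_inv_into (U \<times> V) (map_prod \<phi> \<psi>) s)) (\<phi> ` U \<times> \<psi> ` V)"
    using smooth_funD[OF G prod_atlasI[OF U V]] by (simp add: map_prod_image_Times)
  show "G (the_inv_into (U \<times> V) (map_prod \<phi> \<psi>) z) = G (the_inv_into U \<phi> (fst z), the_inv_into V \<psi> (snd z))"
    if "z \<in> \<phi> ` U \<times> \<psi> ` V" for z
    using that the_inv_into_map_prod[OF A.inj_chart[OF U] B.inj_chart[OF V], of "fst z" "snd z"] by auto
qed

lemma smooth_map_section:
  "smooth_map A (prod_atlas A B) (\<lambda>x. (x, q))" "smooth_map B (prod_atlas A B) (\<lambda>y. (p, y))"
  by (intro smooth_map_Pair smooth_map_id smooth_map_const A.smooth_atlas_axioms B.smooth_atlas_axioms)+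

lemma smooth_fun_section:
  assumes "smooth_fun (prod_atlas A B) G"
  shows "smooth_fun A (\<lambda>x. G (x, q))" "smooth_fun B (\<lambda>y. G (p, y))"
  using smooth_fun_compose[OF A.smooth_atlas_axioms smooth_atlas_AB smooth_map_section(1) assms]
    smooth_fun_compose[OF B.smooth_atlas_axioms smooth_atlas_AB smooth_map_section(2) assms] by auto

lemma section_tvec_of:
  assumes G: "smooth_fun (prod_atlas A B) G" and U: "(U, \<phi>) \<in> A" and V: "(V, \<psi>) \<in> B" "q \<in> V"
    and s: "s \<in> \<phi> ` U"
  shows "tvec_of B (V, \<psi>) q w (\<lambda>y. G (the_inv_into U \<phi> s, y)) =
    frechet_derivative (\<lambda>z. G (the_inv_into U \<phi> (fst z), the_inv_into V \<psi> (snd z))) (at (s, \<psi> q)) (0, w)"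
  using section_derivative(1)[OF smooth_fun_chart_prod[OF G U V(1)], of s "\<psi> q" w] s V(2)
  by (simp add: tvec_of_smooth[OF smooth_fun_section(2)[OF G]])

lemma section_tvec_of':
  assumes G: "smooth_fun (prod_atlas A B) G" and U: "(U, \<phi>) \<in> A" "p \<in> U" and V: "(V, \<psi>) \<in> B"
    and t: "t \<in> \<psi> ` V"
  shows "tvec_of A (U, \<phi>) p v (\<lambda>x. G (x, the_inv_into V \<psi> t)) =
    frechet_derivative (\<lambda>z. G (the_inv_into U \<phi> (fst z), the_inv_into V \<psi> (snd z))) (at (\<phi> p, t)) (v, 0)"
  using section_derivative(2)[OF smooth_fun_chart_prod[OF G U(1) V], of "\<phi> p" t v] t U(2)
  by (simp add: tvec_of_smooth[OF smooth_fun_section(1)[OF G]])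

text \<open>
  In charts, \<open>t\<close> differentiates \<open>G\<close> at a fixed second argument and in a fixed direction, so the
  result is a directional derivative of the chart expression of \<open>G\<close>.
\<close>

lemma smooth_fun_partial:
  assumes G: "smooth_fun (prod_atlas A B) G" and t: "t \<in> tangent_space B q"
  shows "smooth_fun A (\<lambda>x. t (\<lambda>y. G (x, y)))"
proof -
  obtain V \<psi> w where V: "(V, \<psi>) \<in> B" "q \<in> V" "t = tvec_of B (V, \<psi>) q w"
    using t by (auto simp: tangent_space_def)
  have "smooth_on (\<lambda>s. t (\<lambda>y. G (the_inv_into U \<phi> s, y))) (\<phi> ` U)" if U: "(U, \<phi>) \<in> A" for U \<phi>
  proof (rule smooth_on_cong[OF A.open_chart(2)[OF U]])
    note S = A.open_chart(2)[OF U]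
    show "smooth_on (\<lambda>s. frechet_derivative (\<lambda>z. G (the_inv_into U \<phi> (fst z), the_inv_into V \<psi> (snd z)))
        (at (s, \<psi> q)) (0, w)) (\<phi> ` U)"
      using V(2)
      by (intro smooth_on_derivative_along[OF finite_dimensional_prod[OF A.finite_dim B.finite_dim] S _ _
            smooth_fun_chart_prod[OF G U V(1)]] smooth_on_Pair S smooth_on_ident smooth_on_const) auto
  qed (simp add: V(3) section_tvec_of[OF G U V(1,2)])
  then show ?thesis by (auto simp: smooth_fun_def o_def)
qed

text \<open>
  Both sides are the mixed second derivative of the chart expression of \<open>G\<close> along \<open>(v, 0)\<close> and
  \<open>(0, w)\<close>.
\<close>

lemma tangent_commute:
  assumes G: "smooth_fun (prod_atlas A B) G" and s: "s \<in> tangent_space A p" and t: "t \<in> tangent_space B q"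
  shows "s (\<lambda>x. t (\<lambda>y. G (x, y))) = t (\<lambda>y. s (\<lambda>x. G (x, y)))"
proof -
  obtain U \<phi> v where U: "(U, \<phi>) \<in> A" "p \<in> U" "s = tvec_of A (U, \<phi>) p v"
    using s by (auto simp: tangent_space_def)
  obtain V \<psi> w where V: "(V, \<psi>) \<in> B" "q \<in> V" "t = tvec_of B (V, \<psi>) q w"
    using t by (auto simp: tangent_space_def)
  let ?G = "\<lambda>z. G (the_inv_into U \<phi> (fst z), the_inv_into V \<psi> (snd z))"
  let ?S = "\<phi> ` U \<times> \<psi> ` V"
  have G': "smooth_on ?G ?S" by (rule smooth_fun_chart_prod[OF G U(1) V(1)])
  have S: "open ?S" by (intro open_Times A.open_chart[OF U(1)] B.open_chart[OF V(1)])
  have p: "\<phi> p \<in> \<phi> ` U" and q: "\<psi> q \<in> \<psi> ` V" using U V by auto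
  let ?Gw = "\<lambda>z. frechet_derivative ?G (at z) (0, w)" and ?Gv = "\<lambda>z. frechet_derivative ?G (at z) (v, 0)"
  have Gw: "smooth_on ?Gw ?S" and Gv: "smooth_on ?Gv ?S"
    by (rule smooth_on_derivative[OF G'])+
  have "smooth_fun A (\<lambda>x. t (\<lambda>y. G (x, y)))"
    by (rule smooth_fun_partial[OF G t])
  then have "s (\<lambda>x. t (\<lambda>y. G (x, y))) = frechet_derivative (\<lambda>a. t (\<lambda>y. G (the_inv_into U \<phi> a, y))) (at (\<phi> p)) v"
    unfolding U(3) by (rule tvec_of_smooth)
  also have "frechet_derivative (\<lambda>a. t (\<lambda>y. G (the_inv_into U \<phi> a, y))) (at (\<phi> p)) =
      frechet_derivative (\<lambda>a. ?Gw (a, \<psi> q)) (at (\<phi> p))"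
  proof (rule frechet_derivative_cong_open[OF _ A.open_chart(2)[OF U(1)] p])
    show "smooth_on (\<lambda>a. ?Gw (a, \<psi> q)) (\<phi> ` U)"
      by (rule smooth_on_compose[OF finite_dimensional_prod[OF A.finite_dim B.finite_dim] A.open_chart(2)[OF U(1)] _ Gw])
        (use q in \<open>auto intro!: smooth_on_Pair A.open_chart(2)[OF U(1)] smooth_on_ident\<close>)
  qed (simp add: V(3) section_tvec_of[OF G U(1) V(1,2)])
  also have "frechet_derivative (\<lambda>a. ?Gw (a, \<psi> q)) (at (\<phi> p)) v = frechet_derivative ?Gw (at (\<phi> p, \<psi> q)) (v, 0)"
    by (rule section_derivative(2)[OF Gw SigmaI[OF p q]])
  also have "\<dots> = frechet_derivative ?Gv (at (\<phi> p, \<psi> q)) (0, w)"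
    using p q by (intro second_derivative_symmetric[OF S G']) auto
  also have "\<dots> = frechet_derivative (\<lambda>b. ?Gv (\<phi> p, b)) (at (\<psi> q)) w"
    by (rule section_derivative(1)[OF Gv SigmaI[OF p q], symmetric])
  also have "frechet_derivative (\<lambda>b. ?Gv (\<phi> p, b)) (at (\<psi> q)) =
      frechet_derivative (\<lambda>b. s (\<lambda>x. G (x, the_inv_into V \<psi> b))) (at (\<psi> q))"
  proof (rule frechet_derivative_cong_open[symmetric, OF _ B.open_chart(2)[OF V(1)] q])
    show "smooth_on (\<lambda>b. ?Gv (\<phi> p, b)) (\<psi> ` V)"
      by (rule smooth_on_compose[OF finite_dimensional_prod[OF A.finite_dim B.finite_dim] B.open_chart(2)[OF V(1)] _ Gv])
        (use p in \<open>auto intro!: smooth_on_Pair B.open_chart(2)[OF V(1)] smooth_on_ident\<close>)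
  qed (simp add: U(3) section_tvec_of'[OF G U(1,2) V(1)])
  also have "frechet_derivative (\<lambda>b. s (\<lambda>x. G (x, the_inv_into V \<psi> b))) (at (\<psi> q)) w = t (\<lambda>y. s (\<lambda>x. G (x, y)))"
  proof -
    interpret BA: two_atlases B A by unfold_locales
    have "smooth_map (prod_atlas B A) (prod_atlas A B) (\<lambda>z. (snd z, fst z))"
      using A.smooth_atlas_axioms B.smooth_atlas_axioms
      by (intro smooth_map_Pair smooth_map_fst smooth_map_snd smooth_atlas_prod)
    then have "smooth_fun (prod_atlas B A) (\<lambda>z. G (snd z, fst z))"
      using smooth_fun_compose[OF BA.smooth_atlas_AB smooth_atlas_AB _ G] by blast
    from BA.smooth_fun_partial[OF this s] have "smooth_fun B (\<lambda>y. s (\<lambda>x. G (x, y)))" by simp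
    then show ?thesis
      unfolding V(3) by (rule tvec_of_smooth[symmetric])
  qed
  finally show ?thesis .
qed

lemma tvec_of_prod:
  assumes G: "smooth_fun (prod_atlas A B) G" and U: "(U, \<phi>) \<in> A" "p \<in> U" and V: "(V, \<psi>) \<in> B" "q \<in> V"
  shows "tvec_of (prod_atlas A B) (U \<times> V, map_prod \<phi> \<psi>) (p, q) (v, w) G =
    tvec_of A (U, \<phi>) p v (\<lambda>x. G (x, q)) + tvec_of B (V, \<psi>) q w (\<lambda>y. G (p, y))"
proof -
  let ?G = "\<lambda>z. G (the_inv_into U \<phi> (fst z), the_inv_into V \<psi> (snd z))"
  let ?S = "\<phi> ` U \<times> \<psi> ` V"
  have G': "smooth_on ?G ?S" by (rule smooth_fun_chart_prod[OF G U(1) V(1)])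
  have S: "open ?S" by (intro open_Times A.open_chart[OF U(1)] B.open_chart[OF V(1)])
  have p: "\<phi> p \<in> \<phi> ` U" and q: "\<psi> q \<in> \<psi> ` V" using U V by auto
  have "tvec_of (prod_atlas A B) (U \<times> V, map_prod \<phi> \<psi>) (p, q) (v, w) G =
      frechet_derivative (\<lambda>s. G (the_inv_into (U \<times> V) (map_prod \<phi> \<psi>) s)) (at (\<phi> p, \<psi> q)) (v, w)"
    by (simp add: tvec_of_smooth[OF G])
  also have "frechet_derivative (\<lambda>s. G (the_inv_into (U \<times> V) (map_prod \<phi> \<psi>) s)) (at (\<phi> p, \<psi> q)) =
      frechet_derivative ?G (at (\<phi> p, \<psi> q))"
  proof (rule frechet_derivative_cong_open[OF G' S])
    show "?G z = G (the_inv_into (U \<times> V) (map_prod \<phi> \<psi>) z)" if "z \<in> ?S" for z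
      using that the_inv_into_map_prod[OF A.inj_chart[OF U(1)] B.inj_chart[OF V(1)], of "fst z" "snd z"] by auto
  qed (use p q in auto)
  also have "frechet_derivative ?G (at (\<phi> p, \<psi> q)) (v, w) =
      frechet_derivative ?G (at (\<phi> p, \<psi> q)) (v, 0) + frechet_derivative ?G (at (\<phi> p, \<psi> q)) (0, w)"
    using linear_add[OF smooth_on_linear_derivative[OF G'], of "(\<phi> p, \<psi> q)" "(v, 0)" "(0, w)"] p q by simp
  finally show ?thesis
    using section_tvec_of'[OF G U V(1) q, of v] section_tvec_of[OF G U(1) V p, of w]
    by (simp add: is_chart_inv[OF A.chart[OF U(1)]] is_chart_inv[OF B.chart[OF V(1)]] U(2) V(2))
qed

end

text \<open>
  The function that \<open>Z\<close> is applied to may depend on the point.  This is what the coefficients of a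
  field in a moving frame require, since they are found by testing with functions that move along.
  In charts the expression is a derivative on the diagonal, along \<open>(0, v)\<close> for the coefficient \<open>v\<close> of
  \<open>Z\<close>.
\<close>

lemma (in smooth_atlas) smooth_fun_vector_field:
  assumes Z: "vector_field A Z" and G: "smooth_fun (prod_atlas A A) G"
  shows "smooth_fun A (\<lambda>q. Z q (\<lambda>y. G (q, y)))"
proof -
  interpret AA: two_atlases A A by unfold_locales
  have "smooth_on (\<lambda>s. Z (the_inv_into U \<phi> s) (\<lambda>y. G (the_inv_into U \<phi> s, y))) (\<phi> ` U)" if U: "(U, \<phi>) \<in> A" for U \<phi>
  proof -
    note S = open_chart(2)[OF U]
    obtain v where v: "smooth_on v (\<phi> ` U)" "\<And>p. p \<in> U \<Longrightarrow> Z p = tvec_of A (U, \<phi>) p (v (\<phi> p))"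
      using Z U by (fastforce simp: vector_field_def)
    show ?thesis
    proof (rule smooth_on_cong[OF S])
      show "smooth_on (\<lambda>s. frechet_derivative (\<lambda>z. G (the_inv_into U \<phi> (fst z), the_inv_into U \<phi> (snd z)))
          (at (s, s)) (0, v s)) (\<phi> ` U)"
        by (intro smooth_on_derivative_along[OF finite_dimensional_prod[OF finite_dim finite_dim] S _ _
              AA.smooth_fun_chart_prod[OF G U U]] smooth_on_Pair S smooth_on_ident smooth_on_const v(1)) auto
      fix s assume s: "s \<in> \<phi> ` U"
      let ?q = "the_inv_into U \<phi> s"
      have "?q \<in> U" "\<phi> ?q = s" using is_chart_inv[OF chart[OF U]] s by auto
      then show "frechet_derivative (\<lambda>z. G (the_inv_into U \<phi> (fst z), the_inv_into U \<phi> (snd z))) (at (s, s)) (0, v s) =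
          Z ?q (\<lambda>y. G (?q, y))"
        using AA.section_tvec_of[OF G U U, of ?q s "v s"] s v(2) by simp
    qed
  qed
  then show ?thesis by (auto simp: smooth_fun_def o_def)
qed

section \<open>Compact Lie groups with an invariant metric\<close>

lemma orthogonal_complement_nontrivial:
  fixes W :: "'a::real_inner set"
  assumes "finite_dimensional TYPE('a)" and W: "subspace W" "W \<noteq> UNIV"
  obtains u where "u \<noteq> 0" "\<And>z. z \<in> W \<Longrightarrow> u \<bullet> z = 0"
proof -
  obtain T :: "'a set" where T: "finite T" "span T = UNIV"
    using assms(1) by (auto simp: finite_dimensional_def)
  obtain B where B: "B \<subseteq> W" "independent B" "W \<subseteq> span B"
    using maximal_independent_subset[of W] by auto
  have "finite B"
    using independent_span_bound[OF T(1) B(2)] T(2) by auto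
  then obtain C where C: "finite C" "span C = span B" "pairwise orthogonal C"
    using basis_orthogonal by metis
  have "span B = W" using B W(1) by (metis span_subspace)
  then have CW: "span C = W" using C by simp
  obtain y where y: "y \<notin> W" using W by auto
  define u where "u = y - (\<Sum>c\<in>C. (y \<bullet> c / (c \<bullet> c)) *\<^sub>R c)"
  have "u \<bullet> z = 0" if "z \<in> W" for z
    unfolding u_def using that CW by (intro orthogonal_projection_residual C) simp
  moreover have "(\<Sum>c\<in>C. (y \<bullet> c / (c \<bullet> c)) *\<^sub>R c) \<in> W"
    using orthogonal_projection_in_span[of y C] by (simp only: CW)
  then have "u \<noteq> 0" using y by (auto simp: u_def)
  ultimately show thesis using that by blast
qed

lemma orthonormal_basis_expansion:
  assumes "orthonormal_basis n e"
  shows "(\<Sum>i<n. (Y \<bullet> e i) *\<^sub>R e i) = Y" and "(\<Sum>i<n. (Y \<bullet> e i) * (Z \<bullet> e i)) = Y \<bullet> Z"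
proof -
  have on: "e i \<bullet> e j = (if i = j then 1 else 0)" if "i < n" "j < n" for i j
    using assms that by (auto simp: orthonormal_basis_def)
  let ?y = "Y - (\<Sum>i<n. (Y \<bullet> e i) *\<^sub>R e i)"
  have "?y \<bullet> e j = 0" if j: "j < n" for j
  proof -
    have "(\<Sum>i<n. (Y \<bullet> e i) *\<^sub>R e i) \<bullet> e j = (\<Sum>i<n. if i = j then Y \<bullet> e j else 0)"
      unfolding inner_sum_left by (intro sum.cong) (auto simp: on j)
    then show ?thesis using j by (simp add: inner_diff_left)
  qed
  then have "orthogonal ?y z" if "z \<in> span (e ` {..<n})" for z
    using orthogonal_to_span[OF that, of ?y] by (auto simp: orthogonal_def)
  then have "orthogonal ?y ?y"
    using assms by (simp add: orthonormal_basis_def)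
  then show eq: "(\<Sum>i<n. (Y \<bullet> e i) *\<^sub>R e i) = Y"
    by (simp add: orthogonal_def)
  have "Z \<bullet> (\<Sum>i<n. (Y \<bullet> e i) *\<^sub>R e i) = (\<Sum>i<n. (Y \<bullet> e i) * (Z \<bullet> e i))"
    by (simp add: inner_sum_right)
  then show "(\<Sum>i<n. (Y \<bullet> e i) * (Z \<bullet> e i)) = Y \<bullet> Z"
    unfolding eq by (simp add: inner_commute)
qed

lemma orthonormal_basis_finite_dimensional:
  "orthonormal_basis n (e :: nat \<Rightarrow> 'g::real_inner) \<Longrightarrow> finite_dimensional TYPE('g)"
  unfolding finite_dimensional_def orthonormal_basis_def
  by (intro exI[of _ "e ` {..<n}"]) auto

locale metric_lie_group = compact_lie_group K A
  for K :: "'k::{t2_space, second_countable_topology} monoid"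
    and A :: "('k, 'e::real_inner) atlas" +
  fixes L :: "'g::real_inner \<Rightarrow> 'k tvec" and n :: nat and e :: "nat \<Rightarrow> 'g"
  assumes L: "lie_algebra_iso K A L"
    and Ad_invariant: "\<And>g Y Z. Ad K A L g Y \<bullet> Ad K A L g Z = Y \<bullet> Z"
    and e: "orthonormal_basis n e"
begin

sublocale KA: smooth_atlas A by (rule smooth_atlas)
sublocale KK: two_atlases A A by unfold_locales

lemma in_carrier [simp]: "x \<in> carrier K" by (simp add: carrier_eq)

lemmas expansion = orthonormal_basis_expansion(1)[OF e]
  and inner_expansion = orthonormal_basis_expansion(2)[OF e]
  and finite_dim_g = orthonormal_basis_finite_dimensional[OF e]

lemma smooth_map_mult:
  assumes "smooth_atlas B" "smooth_map B A F" "smooth_map B A G"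
  shows "smooth_map B A (\<lambda>x. F x \<otimes>\<^bsub>K\<^esub> G x)"
  using smooth_map_compose[OF assms(1) KK.smooth_atlas_AB KA.smooth_atlas_axioms
      smooth_map_Pair[OF assms(1) KA.smooth_atlas_axioms KA.smooth_atlas_axioms assms(2,3)] smooth_mult]
  by simp

lemma smooth_map_inv:
  assumes "smooth_atlas B" "smooth_map B A F"
  shows "smooth_map B A (\<lambda>x. inv\<^bsub>K\<^esub> F x)"
  using smooth_map_compose[OF assms(1) KA.smooth_atlas_axioms KA.smooth_atlas_axioms assms(2) smooth_inv] .

lemmas smooth_map_group = smooth_map_mult smooth_map_inv smooth_map_id smooth_map_const
  smooth_map_fst smooth_map_snd smooth_atlas_prod KA.smooth_atlas_axioms

lemma smooth_fun_group:
  "smooth_atlas B \<Longrightarrow> smooth_map B A F \<Longrightarrow> smooth_fun A f \<Longrightarrow> smooth_fun B (\<lambda>x. f (F x))"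
  by (rule smooth_fun_compose[OF _ KA.smooth_atlas_axioms])

lemma smooth_fun_mult_left: "smooth_fun A f \<Longrightarrow> smooth_fun A (\<lambda>y. f (x \<otimes>\<^bsub>K\<^esub> y))"
  by (rule smooth_fun_group[OF KA.smooth_atlas_axioms]) (intro smooth_map_group)

lemma smooth_fun_mult_right: "smooth_fun A f \<Longrightarrow> smooth_fun A (\<lambda>y. f (y \<otimes>\<^bsub>K\<^esub> x))"
  by (rule smooth_fun_group[OF KA.smooth_atlas_axioms]) (intro smooth_map_group)

lemma L_tangent: "L Y \<in> tangent_space A \<one>\<^bsub>K\<^esub>"
  using L by (auto simp: lie_algebra_iso_def bij_betw_def)

lemma L_surj: "v \<in> tangent_space A \<one>\<^bsub>K\<^esub> \<Longrightarrow> \<exists>Y. v = L Y"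
  using L by (auto simp: lie_algebra_iso_def bij_betw_def)

lemma L_inj: "L Y = L Z \<longleftrightarrow> Y = Z"
  using L by (auto simp: lie_algebra_iso_def bij_betw_def inj_on_def)

lemma L_linear: "linear (\<lambda>Y. L Y f)"
  using L by (auto simp: lie_algebra_iso_def)

lemma L_sum: "L (\<Sum>i\<in>I. c i *\<^sub>R Z i) f = (\<Sum>i\<in>I. c i * L (Z i) f)"
  by (simp add: linear_sum[OF L_linear] linear_scale[OF L_linear])

lemma L_expansion: "(\<Sum>i<n. (Y \<bullet> e i) * L (e i) f) = L Y f"
  using L_sum[of "\<lambda>i. Y \<bullet> e i" e "{..<n}" f] by (simp add: expansion)

lemma L_zero: "L 0 f = 0"
  by (rule linear_0[OF L_linear])

lemma L_const: "L Y (\<lambda>x. c) = 0"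
  by (rule KA.tangent_const[OF L_tangent])

text \<open>
  The vectors \<open>z\<close> that arise in this way form a subspace \<open>W\<close>.  By duality every smooth \<open>f\<close> produces
  one of them, namely the gradient of \<open>f\<close> at the identity.  A vector \<open>u\<close> orthogonal to \<open>W\<close> therefore
  annihilates all smooth functions, so \<open>L u = L 0\<close> and \<open>u = 0\<close>.
\<close>

lemma exists_coordinate: "\<exists>f. smooth_fun A f \<and> (\<forall>Y. L Y f = Y \<bullet> z)"
proof -
  define W where "W = {z. \<exists>f. smooth_fun A f \<and> (\<forall>Y. L Y f = Y \<bullet> z)}"
  have in_W: "(\<Sum>i<n. L (e i) f *\<^sub>R e i) \<in> W" if "smooth_fun A f" for f
  proof -
    have "L Y f = Y \<bullet> (\<Sum>i<n. L (e i) f *\<^sub>R e i)" for Y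
      using L_expansion[of Y f] by (simp add: inner_sum_right mult.commute)
    then show ?thesis using that unfolding W_def by blast
  qed
  have sub: "subspace W"
  proof (rule subspaceI)
    show "0 \<in> W" using L_const[of _ 0] unfolding W_def by (auto intro!: exI[of _ "\<lambda>x. 0"])
  next
    fix z w assume "z \<in> W" "w \<in> W"
    then obtain f g where fg: "smooth_fun A f" "\<And>Y. L Y f = Y \<bullet> z" "smooth_fun A g" "\<And>Y. L Y g = Y \<bullet> w"
      by (auto simp: W_def)
    then have "smooth_fun A (\<lambda>x. f x + g x)" "L Y (\<lambda>x. f x + g x) = Y \<bullet> (z + w)" for Y
      by (auto simp: KA.smooth_fun_add KA.tangent_add[OF L_tangent] inner_add_right)
    then show "z + w \<in> W" unfolding W_def by blast
  next
    fix c z assume "z \<in> W"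
    then obtain f where f: "smooth_fun A f" "\<And>Y. L Y f = Y \<bullet> z"
      by (auto simp: W_def)
    then have "smooth_fun A (\<lambda>x. c * f x)" "L Y (\<lambda>x. c * f x) = Y \<bullet> (c *\<^sub>R z)" for Y
      by (auto simp: KA.smooth_fun_mult KA.tangent_cmult[OF L_tangent])
    then show "c *\<^sub>R z \<in> W" unfolding W_def by blast
  qed
  have "W = UNIV"
  proof (rule ccontr)
    assume ne: "W \<noteq> UNIV"
    obtain u where u: "u \<noteq> 0" "\<And>z. z \<in> W \<Longrightarrow> u \<bullet> z = 0"
      using orthogonal_complement_nontrivial[OF finite_dim_g sub ne] by blast
    have "L u f = L 0 f" for f
    proof (cases "smooth_fun A f")
      case True
      have "L u f = u \<bullet> (\<Sum>i<n. L (e i) f *\<^sub>R e i)"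
        using L_expansion[of u f] by (simp add: inner_sum_right mult.commute)
      then show ?thesis using u(2)[OF in_W[OF True]] L_zero by simp
    next
      case False
      then show ?thesis by (simp add: L_zero tangent_space_not_smooth[OF L_tangent])
    qed
    then have "L u = L 0" ..
    then show False using u(1) L_inj by simp
  qed
  then show ?thesis unfolding W_def by blast
qed

definition coordinate :: "'g \<Rightarrow> 'k \<Rightarrow> real" where
  "coordinate z = (SOME f. smooth_fun A f \<and> (\<forall>Y. L Y f = Y \<bullet> z))"

lemma coordinate: "smooth_fun A (coordinate z)" "L Y (coordinate z) = Y \<bullet> z"
  using someI_ex[OF exists_coordinate[of z]] by (auto simp: coordinate_def)

lemma left_invariant_smooth:
  "smooth_fun A f \<Longrightarrow> left_invariant K A v x f = v (\<lambda>y. f (x \<otimes>\<^bsub>K\<^esub> y))"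
  by (simp add: left_invariant_def pushforward_smooth)

lemma left_invariant_not_smooth: "\<not> smooth_fun A f \<Longrightarrow> left_invariant K A v x f = 0"
  by (simp add: left_invariant_def pushforward_not_smooth)

text \<open>
  Translation by the inverse of \<open>x\<close> carries \<open>t\<close> to the tangent space at the identity.
\<close>

lemma tangent_left_invariant:
  assumes t: "t \<in> tangent_space A x"
  obtains Y where "t = left_invariant K A (L Y) x"
proof -
  let ?l = "\<lambda>z. inv\<^bsub>K\<^esub> x \<otimes>\<^bsub>K\<^esub> z"
  have "smooth_map A A ?l"
    by (intro smooth_map_group)
  from pushforward_tangent_space[OF KA.smooth_atlas_axioms KA.smooth_atlas_axioms this t]
  have "pushforward A A ?l t \<in> tangent_space A \<one>\<^bsub>K\<^esub>" by simp
  then obtain Y where Y: "pushforward A A ?l t = L Y" using L_surj by metis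
  have "t f = left_invariant K A (L Y) x f" for f
  proof (cases "smooth_fun A f")
    case True
    have "left_invariant K A (L Y) x f = t (\<lambda>z. f (x \<otimes>\<^bsub>K\<^esub> (inv\<^bsub>K\<^esub> x \<otimes>\<^bsub>K\<^esub> z)))"
      by (simp add: left_invariant_smooth[OF True] Y[symmetric] pushforward_smooth smooth_fun_mult_left True)
    also have "(\<lambda>z. f (x \<otimes>\<^bsub>K\<^esub> (inv\<^bsub>K\<^esub> x \<otimes>\<^bsub>K\<^esub> z))) = f"
      by (simp add: m_assoc[symmetric])
    finally show ?thesis by simp
  next
    case False
    then show ?thesis by (simp add: left_invariant_not_smooth tangent_space_not_smooth[OF t])
  qed
  then show thesis using that by blast
qed

text \<open>
  Translated coordinate functions extract the components of a vector in the left-invariant frame.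
  They show that the frame is linearly independent and that components depend smoothly on the
  point.
\<close>

lemma left_invariant_coordinate:
  "left_invariant K A (L Y) x (\<lambda>y. coordinate z (inv\<^bsub>K\<^esub> x \<otimes>\<^bsub>K\<^esub> y)) = Y \<bullet> z"
  by (simp add: left_invariant_smooth smooth_fun_mult_left coordinate m_assoc[symmetric])

lemma left_invariant_expansion:
  "(\<Sum>i<n. (Y \<bullet> e i) * left_invariant K A (L (e i)) x f) = left_invariant K A (L Y) x f"
  by (cases "smooth_fun A f") (simp_all add: left_invariant_smooth left_invariant_not_smooth L_expansion)

lemma dual_frame_left_invariant:
  assumes i: "i < n"
  shows "dual_frame K A L n e i x (left_invariant K A (L Y) x) = Y \<bullet> e i"
proof -
  have on: "e i \<bullet> e j = (if i = j then 1 else 0)" if "i < n" "j < n" for i j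
    using e that by (auto simp: orthonormal_basis_def)
  let ?P = "\<lambda>c. (\<forall>j\<ge>n. c j = 0) \<and>
    left_invariant K A (L Y) x = (\<lambda>f. \<Sum>j<n. c j * left_invariant K A (L (e j)) x f)"
  let ?c = "\<lambda>j. if j < n then Y \<bullet> e j else 0"
  have "(THE c. ?P c) = ?c"
  proof (rule the_equality)
    have "left_invariant K A (L Y) x f = (\<Sum>j<n. ?c j * left_invariant K A (L (e j)) x f)" for f
      unfolding left_invariant_expansion[of Y x f, symmetric] by (intro sum.cong) auto
    then show "?P ?c" by auto
  next
    fix c assume c: "?P c"
    have "c j = ?c j" for j
    proof (cases "j < n")
      case True
      let ?f = "\<lambda>y. coordinate (e j) (inv\<^bsub>K\<^esub> x \<otimes>\<^bsub>K\<^esub> y)"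
      have "Y \<bullet> e j = left_invariant K A (L Y) x ?f"
        by (rule left_invariant_coordinate[symmetric])
      also have "\<dots> = (\<Sum>k<n. c k * left_invariant K A (L (e k)) x ?f)"
        using c by metis
      also have "\<dots> = (\<Sum>k<n. if k = j then c j else 0)"
        by (intro sum.cong) (auto simp: left_invariant_coordinate on True)
      finally show ?thesis using True by simp
    qed (use c in auto)
    then show "c = ?c" ..
  qed
  then show ?thesis using i by (simp add: dual_frame_def)
qed

text \<open>
  The left-invariant field of \<open>Y\<close> as an operator on functions.
\<close>

definition lie_deriv :: "'g \<Rightarrow> ('k \<Rightarrow> real) \<Rightarrow> 'k \<Rightarrow> real" where
  "lie_deriv Y f x = L Y (\<lambda>y. f (x \<otimes>\<^bsub>K\<^esub> y))"

lemma smooth_fun_mult_fst_snd: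
  "smooth_fun A f \<Longrightarrow> smooth_fun (prod_atlas A A) (\<lambda>z. f (fst z \<otimes>\<^bsub>K\<^esub> snd z))"
  by (rule smooth_fun_group) (intro smooth_map_group)+

lemma smooth_fun_mult_snd_fst:
  "smooth_fun A f \<Longrightarrow> smooth_fun (prod_atlas A A) (\<lambda>z. f (snd z \<otimes>\<^bsub>K\<^esub> fst z))"
  by (rule smooth_fun_group) (intro smooth_map_group)+

lemma smooth_lie_deriv: "smooth_fun A f \<Longrightarrow> smooth_fun A (lie_deriv Y f)"
  using KK.smooth_fun_partial[OF smooth_fun_mult_fst_snd L_tangent, of f Y]
  by (simp add: lie_deriv_def[abs_def])

lemma lie_deriv_expansion: "(\<Sum>i<n. (Y \<bullet> e i) * lie_deriv (e i) f x) = lie_deriv Y f x"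
  by (simp add: lie_deriv_def L_expansion)

lemma left_invariant_lie_deriv: "smooth_fun A f \<Longrightarrow> left_invariant K A (L Y) x f = lie_deriv Y f x"
  by (simp add: left_invariant_smooth lie_deriv_def)

lemma lie_deriv_translate: "lie_deriv Y f (x \<otimes>\<^bsub>K\<^esub> z) = lie_deriv Y (\<lambda>y. f (x \<otimes>\<^bsub>K\<^esub> y)) z"
  by (simp add: lie_deriv_def m_assoc)

abbreviation ad_action :: "'k \<Rightarrow> 'g \<Rightarrow> 'g" where
  "ad_action \<equiv> Ad K A L"

lemma L_Ad:
  assumes f: "smooth_fun A f"
  shows "L (ad_action g Y) f = L Y (\<lambda>x. f (g \<otimes>\<^bsub>K\<^esub> x \<otimes>\<^bsub>K\<^esub> inv\<^bsub>K\<^esub> g))"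
proof -
  let ?c = "\<lambda>x. g \<otimes>\<^bsub>K\<^esub> x \<otimes>\<^bsub>K\<^esub> inv\<^bsub>K\<^esub> g"
  have "smooth_map A A ?c"
    by (intro smooth_map_group)
  from pushforward_tangent_space[OF KA.smooth_atlas_axioms KA.smooth_atlas_axioms this L_tangent]
  have "pushforward A A ?c (L Y) \<in> tangent_space A \<one>\<^bsub>K\<^esub>" by simp
  then obtain Z where Z: "pushforward A A ?c (L Y) = L Z" using L_surj by metis
  have "inj L" using L_inj by (auto simp: inj_def)
  then have "ad_action g Y = Z"
    by (simp add: Ad_def Z the_inv_f_f)
  then show ?thesis by (simp add: Z[symmetric] pushforward_smooth[OF f])
qed

lemma Ad_one: "ad_action \<one>\<^bsub>K\<^esub> Y = Y"
proof -
  have "L (ad_action \<one>\<^bsub>K\<^esub> Y) f = L Y f" for f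
    by (cases "smooth_fun A f") (simp_all add: L_Ad tangent_space_not_smooth[OF L_tangent])
  then have "L (ad_action \<one>\<^bsub>K\<^esub> Y) = L Y" ..
  then show ?thesis by (simp add: L_inj)
qed

lemma smooth_fun_Ad: "smooth_fun A (\<lambda>g. ad_action g Y \<bullet> z)"
proof -
  have "smooth_fun (prod_atlas A A) (\<lambda>p. coordinate z (fst p \<otimes>\<^bsub>K\<^esub> snd p \<otimes>\<^bsub>K\<^esub> inv\<^bsub>K\<^esub> fst p))"
    by (rule smooth_fun_group[OF _ _ coordinate(1)]) (intro smooth_map_group)+
  from KK.smooth_fun_partial[OF this L_tangent, of Y] show ?thesis
    by (simp add: L_Ad[OF coordinate(1), symmetric] coordinate(2))
qed

text \<open>
  The Lie bracket, introduced as the derivative at the identity of \<open>g \<mapsto> Ad\<^sub>g b\<close> in the direction \<open>a\<close>.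
  In this form it is ready for differentiating invariance conditions.
\<close>

definition bracket :: "'g \<Rightarrow> 'g \<Rightarrow> 'g" where
  "bracket a b = (\<Sum>i<n. L a (\<lambda>g. ad_action g b \<bullet> e i) *\<^sub>R e i)"

text \<open>
  Moving \<open>y\<close> past \<open>x\<close> in \<open>f(x y) = f((x y x\<^sup>-\<^sup>1) x)\<close> trades the left-invariant field for
  right-invariant ones with coefficients from \<open>Ad\<^sub>x b\<close>.
\<close>

lemma lie_deriv_Ad:
  assumes f: "smooth_fun A f"
  shows "lie_deriv b f x = (\<Sum>i<n. (ad_action x b \<bullet> e i) * L (e i) (\<lambda>y. f (y \<otimes>\<^bsub>K\<^esub> x)))"
proof -
  have "lie_deriv b f x = L b (\<lambda>y. f ((x \<otimes>\<^bsub>K\<^esub> y \<otimes>\<^bsub>K\<^esub> inv\<^bsub>K\<^esub> x) \<otimes>\<^bsub>K\<^esub> x))"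
    by (simp add: lie_deriv_def m_assoc)
  also have "\<dots> = L (ad_action x b) (\<lambda>y. f (y \<otimes>\<^bsub>K\<^esub> x))"
    by (rule L_Ad[OF smooth_fun_mult_right[OF f], symmetric])
  finally show ?thesis by (simp add: L_expansion)
qed

text \<open>
  The product rule is applied to the expression of lemma \<open>lie_deriv_Ad\<close>.  The derivatives of the
  coefficients \<open>Ad\<^sub>x b\<close> yield the bracket; in the remaining terms the two differentiations commute,
  since one acts on the left and the other on the right factor of a product, and these terms sum up
  to \<open>L b (lie_deriv a f)\<close>.
\<close>

lemma bracket_at_one:
  assumes f: "smooth_fun A f"
  shows "L a (lie_deriv b f) - L b (lie_deriv a f) = L (bracket a b) f"
proof -
  let ?r = "\<lambda>i g. ad_action g b \<bullet> e i" and ?R = "\<lambda>i x. L (e i) (\<lambda>y. f (y \<otimes>\<^bsub>K\<^esub> x))"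
  have R: "smooth_fun A (?R i)" for i
    using KK.smooth_fun_partial[OF smooth_fun_mult_snd_fst[OF f] L_tangent, of "e i"] by simp
  have "L a (lie_deriv b f) = L a (\<lambda>x. \<Sum>i<n. ?r i x * ?R i x)"
    using lie_deriv_Ad[OF f] by presburger
  also have "\<dots> = (\<Sum>i<n. ?r i \<one>\<^bsub>K\<^esub> * L a (?R i) + L a (?r i) * ?R i \<one>\<^bsub>K\<^esub>)"
    by (simp add: KA.tangent_sum[OF L_tangent] KA.tangent_mult[OF L_tangent] KA.smooth_fun_mult smooth_fun_Ad R)
  also have "\<dots> = (\<Sum>i<n. (b \<bullet> e i) * L (e i) (lie_deriv a f)) + (\<Sum>i<n. L a (?r i) * L (e i) f)"
  proof -
    have "L a (?R i) = L (e i) (lie_deriv a f)" for i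
      using KK.tangent_commute[OF smooth_fun_mult_snd_fst[OF f] L_tangent L_tangent, of a "e i"]
      by (simp add: lie_deriv_def[abs_def])
    then show ?thesis by (simp add: sum.distrib Ad_one)
  qed
  also have "\<dots> = L b (lie_deriv a f) + L (bracket a b) f"
    by (simp add: L_expansion bracket_def L_sum)
  finally show ?thesis by simp
qed

lemma lie_deriv_bracket:
  assumes f: "smooth_fun A f"
  shows "lie_deriv a (lie_deriv b f) x - lie_deriv b (lie_deriv a f) x = lie_deriv (bracket a b) f x"
proof -
  have "lie_deriv c (lie_deriv d f) x = L c (lie_deriv d (\<lambda>y. f (x \<otimes>\<^bsub>K\<^esub> y)))" for c d
    by (simp add: lie_deriv_def[of c] lie_deriv_translate)
  then show ?thesis
    using bracket_at_one[OF smooth_fun_mult_left[OF f], of a b x] by (simp add: lie_deriv_def[of "bracket a b"])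
qed

lemma tangent_Ad_inner:
  assumes i: "i < n"
  shows "L a (\<lambda>g. ad_action g b \<bullet> e i) = bracket a b \<bullet> e i"
proof -
  have "bracket a b \<bullet> e i = (\<Sum>j<n. if j = i then L a (\<lambda>g. ad_action g b \<bullet> e i) else 0)"
    unfolding bracket_def inner_sum_left
    using e i by (intro sum.cong) (auto simp: orthonormal_basis_def)
  then show ?thesis using i by simp
qed

text \<open>
  The derivative at \<open>g = 1\<close> of the constant function \<open>g \<mapsto> Ad\<^sub>g Y \<cdot> Ad\<^sub>g u\<close>.
\<close>

lemma bracket_skew: "bracket a Y \<bullet> u + Y \<bullet> bracket a u = 0"
proof -
  have "(\<lambda>g. \<Sum>i<n. (ad_action g Y \<bullet> e i) * (ad_action g u \<bullet> e i)) = (\<lambda>g. Y \<bullet> u)"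
    by (simp add: inner_expansion Ad_invariant)
  then have "0 = L a (\<lambda>g. \<Sum>i<n. (ad_action g Y \<bullet> e i) * (ad_action g u \<bullet> e i))"
    by (simp add: L_const)
  also have "\<dots> = (\<Sum>i<n. (Y \<bullet> e i) * L a (\<lambda>g. ad_action g u \<bullet> e i) + L a (\<lambda>g. ad_action g Y \<bullet> e i) * (u \<bullet> e i))"
    by (simp add: KA.tangent_sum[OF L_tangent] KA.tangent_mult[OF L_tangent] KA.smooth_fun_mult smooth_fun_Ad Ad_one)
  also have "\<dots> = (\<Sum>i<n. (Y \<bullet> e i) * (bracket a u \<bullet> e i) + (bracket a Y \<bullet> e i) * (u \<bullet> e i))"
    by (intro sum.cong refl) (simp add: tangent_Ad_inner)
  also have "\<dots> = Y \<bullet> bracket a u + bracket a Y \<bullet> u"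
    by (simp add: sum.distrib inner_expansion)
  finally show ?thesis by simp
qed

lemma grad_inner:
  assumes "smooth_on h UNIV"
  shows "grad n e h Y \<bullet> v = frechet_derivative h (at Y) v"
proof -
  have lin: "linear (frechet_derivative h (at Y))"
    by (rule smooth_on_linear_derivative[OF assms UNIV_I])
  have "frechet_derivative h (at Y) v = frechet_derivative h (at Y) (\<Sum>i<n. (v \<bullet> e i) *\<^sub>R e i)"
    by (simp add: expansion)
  also have "\<dots> = (\<Sum>i<n. (v \<bullet> e i) * frechet_derivative h (at Y) (e i))"
    by (simp add: linear_sum[OF lin] linear_scale[OF lin])
  also have "\<dots> = grad n e h Y \<bullet> v"
    by (simp add: grad_def partial_def inner_sum_left inner_commute[of v] mult.commute)
  finally show ?thesis by simp
qed

text \<open>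
  The derivative at \<open>g = 1\<close> of the constant function \<open>g \<mapsto> h(Ad\<^sub>g Y)\<close>.
\<close>

lemma invariant_grad_orthogonal:
  assumes h: "smooth_on h UNIV" and inv: "\<And>g Y. h (ad_action g Y) = h Y"
  shows "grad n e h Y \<bullet> bracket a Y = 0"
proof -
  let ?r = "\<lambda>i g. ad_action g Y \<bullet> e i"
  have "0 = L a (\<lambda>g. h (\<Sum>i<n. ?r i g *\<^sub>R e i))"
    by (simp add: expansion inv L_const)
  also have "\<dots> = frechet_derivative h (at (\<Sum>i<n. ?r i \<one>\<^bsub>K\<^esub> *\<^sub>R e i)) (\<Sum>i<n. L a (?r i) *\<^sub>R e i)"
    by (rule KA.tangent_chain[OF L_tangent finite_dim_g h]) (auto simp: smooth_fun_Ad)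
  also have "\<dots> = grad n e h Y \<bullet> bracket a Y"
    by (simp add: grad_inner[OF h] expansion Ad_one bracket_def)
  finally show ?thesis by simp
qed

text \<open>
  Invariance of the metric turns the left-hand side into \<open>- [a, Y] \<cdot> u\<close>.  Up to sign this is the
  derivative of \<open>h\<close> along the adjoint orbit of \<open>Y\<close>, on which \<open>h\<close> is constant.
\<close>

lemma grad_bracket:
  assumes h: "smooth_on h UNIV" and inv: "\<And>g Y. h (ad_action g Y) = h Y"
  shows "Y \<bullet> bracket a (grad n e h Y) = 0"
  using bracket_skew[of a Y "grad n e h Y"] invariant_grad_orthogonal[OF assms, of Y a]
  by (simp add: inner_commute)

lemma bracket_antisym: "bracket a b = - bracket b a"
proof -
  have "L (bracket a b) f = L (- bracket b a) f" for f
  proof (cases "smooth_fun A f")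
    case True
    then show ?thesis
      using bracket_at_one[OF True, of a b] bracket_at_one[OF True, of b a]
      by (simp add: linear_neg[OF L_linear])
  qed (simp add: tangent_space_not_smooth[OF L_tangent])
  then have "L (bracket a b) = L (- bracket b a)" ..
  then show ?thesis by (simp add: L_inj)
qed

end

section \<open>The cotangent bundle and its canonical form\<close>

lemma smooth_fun_vector_space: "smooth_fun {(UNIV, id)} g \<longleftrightarrow> smooth_on g UNIV"
  by (simp add: smooth_fun_def the_inv_into_id)

lemma tvec_of_vector_space:
  "smooth_on g UNIV \<Longrightarrow> tvec_of {(UNIV, id)} (UNIV, id) Y d g = frechet_derivative g (at Y) d"
  by (simp add: tvec_of_smooth smooth_fun_vector_space the_inv_into_id)

context metric_lie_group
begin

abbreviation M :: "('k \<times> 'g, 'e \<times> 'g) atlas" where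
  "M \<equiv> prod_atlas A {(UNIV, id)}"

sublocale KM: two_atlases A "{(UNIV, id :: 'g \<Rightarrow> 'g)}"
  by (rule two_atlases.intro[OF KA.smooth_atlas_axioms smooth_atlas_id[OF finite_dim_g]])

sublocale M: smooth_atlas M by (rule KM.smooth_atlas_AB)

text \<open>
  In charts the coefficient \<open>\<xi>\<close> of a left-invariant field is the derivative of the multiplication
  with respect to its second argument at the identity.  The chart expression of the multiplication
  is defined only on \<open>W\<close>, the pairs whose product stays in \<open>U\<close>; this set contains \<open>(x, 1)\<close> for all
  \<open>x\<close> in \<open>U\<close>.
\<close>

lemma left_invariant_chart:
  assumes U: "(U, \<phi>) \<in> A"
  obtains \<xi> where "smooth_on \<xi> (\<phi> ` U)"
    "\<And>x. x \<in> U \<Longrightarrow> left_invariant K A (L b) x = tvec_of A (U, \<phi>) x (\<xi> (\<phi> x))"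
proof -
  obtain V \<psi> where V: "(V, \<psi>) \<in> A" "\<one>\<^bsub>K\<^esub> \<in> V" by (rule KA.chart_at)
  obtain \<beta> where \<beta>: "L b = tvec_of A (V, \<psi>) \<one>\<^bsub>K\<^esub> \<beta>"
    by (rule KA.tangent_space_chart[OF L_tangent V])
  let ?inv = "the_inv_into (U \<times> V) (map_prod \<phi> \<psi>)"
  let ?m = "\<lambda>(x, y). x \<otimes>\<^bsub>K\<^esub> y"
  let ?W = "map_prod \<phi> \<psi> ` ((U \<times> V) \<inter> ?m -` U)"
  let ?G = "\<lambda>z. \<phi> (?m (?inv z))"
  have G: "smooth_on ?G ?W"
    by (rule smooth_mapD[OF smooth_mult prod_atlasI[OF U V(1)] U])
  define \<xi> where "\<xi> s = frechet_derivative ?G (at (s, \<psi> \<one>\<^bsub>K\<^esub>)) (0, \<beta>)" for s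
  have W: "(s, \<psi> \<one>\<^bsub>K\<^esub>) \<in> ?W" if s: "s \<in> \<phi> ` U" for s
  proof -
    obtain x where x: "x \<in> U" "s = \<phi> x" using s by auto
    then have "(x, \<one>\<^bsub>K\<^esub>) \<in> (U \<times> V) \<inter> ?m -` U" using V by simp
    from imageI[OF this, of "map_prod \<phi> \<psi>"] show ?thesis using x by simp
  qed
  have "smooth_on \<xi> (\<phi> ` U)"
    unfolding \<xi>_def
    using W
    by (intro smooth_on_derivative_along[OF finite_dimensional_prod[OF KA.finite_dim KA.finite_dim] KA.open_chart(2)[OF U] _ _ G]
        smooth_on_Pair KA.open_chart(2)[OF U] smooth_on_ident smooth_on_const) auto
  moreover have "left_invariant K A (L b) x = tvec_of A (U, \<phi>) x (\<xi> (\<phi> x))" if x: "x \<in> U" for x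
  proof -
    have xs: "\<phi> x \<in> \<phi> ` U" using x by auto
    have sm: "smooth_map A A (\<lambda>z. x \<otimes>\<^bsub>K\<^esub> z)"
      by (intro smooth_map_group)
    have "left_invariant K A (L b) x =
        tvec_of A (U, \<phi>) x (frechet_derivative (\<lambda>t. \<phi> (x \<otimes>\<^bsub>K\<^esub> the_inv_into V \<psi> t)) (at (\<psi> \<one>\<^bsub>K\<^esub>)) \<beta>)"
      using pushforward_tvec_of[OF KA.smooth_atlas_axioms KA.smooth_atlas_axioms sm V U, of \<beta>] x
      by (simp add: left_invariant_def \<beta>)
    also have "frechet_derivative (\<lambda>t. \<phi> (x \<otimes>\<^bsub>K\<^esub> the_inv_into V \<psi> t)) (at (\<psi> \<one>\<^bsub>K\<^esub>)) =
        frechet_derivative (\<lambda>t. ?G (\<phi> x, t)) (at (\<psi> \<one>\<^bsub>K\<^esub>))"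
    proof (rule frechet_derivative_cong_open[where S = "\<psi> ` (V \<inter> (\<lambda>z. x \<otimes>\<^bsub>K\<^esub> z) -` U)"])
      show op: "open (\<psi> ` (V \<inter> (\<lambda>z. x \<otimes>\<^bsub>K\<^esub> z) -` U))"
        using KA.open_chart(1)[OF U] smooth_map_continuous[OF sm]
        by (intro is_chart_open_image[OF KA.chart[OF V(1)]]) (simp add: continuous_on_open_vimage open_vimage)
      show "\<psi> \<one>\<^bsub>K\<^esub> \<in> \<psi> ` (V \<inter> (\<lambda>z. x \<otimes>\<^bsub>K\<^esub> z) -` U)" using V x by auto
      show eq: "?G (\<phi> x, t) = \<phi> (x \<otimes>\<^bsub>K\<^esub> the_inv_into V \<psi> t)"
        if "t \<in> \<psi> ` (V \<inter> (\<lambda>z. x \<otimes>\<^bsub>K\<^esub> z) -` U)" for t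
        using that xs x by (auto simp: the_inv_into_map_prod[OF KA.inj_chart[OF U] KA.inj_chart[OF V(1)]]
            is_chart_inv[OF KA.chart[OF U]])
      show "smooth_on (\<lambda>t. ?G (\<phi> x, t)) (\<psi> ` (V \<inter> (\<lambda>z. x \<otimes>\<^bsub>K\<^esub> z) -` U))"
        by (rule smooth_on_cong[OF op eq[symmetric] smooth_mapD[OF sm V(1) U]])
    qed
    also have "frechet_derivative (\<lambda>t. ?G (\<phi> x, t)) (at (\<psi> \<one>\<^bsub>K\<^esub>)) \<beta> = \<xi> (\<phi> x)"
      unfolding \<xi>_def by (rule section_derivative(1)[OF G W[OF xs]])
    finally show ?thesis .
  qed
  ultimately show thesis using that by blast
qed

text \<open>
  The tangent vector of \<open>K \<times> Lie(K)\<close> at \<open>(x, Y)\<close> whose component along \<open>K\<close> is the left-invariant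
  vector generated by \<open>a\<close> and whose component along \<open>Lie(K)\<close> is \<open>d\<close>.
\<close>

definition split_tvec :: "'k \<Rightarrow> 'g \<Rightarrow> 'g \<Rightarrow> 'g \<Rightarrow> ('k \<times> 'g) tvec" where
  "split_tvec x Y a d = (\<lambda>F. if smooth_fun M F
     then lie_deriv a (\<lambda>x'. F (x', Y)) x + frechet_derivative (\<lambda>Y'. F (x, Y')) (at Y) d else 0)"

lemma tvec_of_split:
  assumes U: "(U, \<phi>) \<in> A" "x \<in> U" and a: "tvec_of A (U, \<phi>) x v = left_invariant K A (L a) x"
  shows "tvec_of M (U \<times> UNIV, map_prod \<phi> id) (x, Y) (v, d) = split_tvec x Y a d"
proof
  fix F
  show "tvec_of M (U \<times> UNIV, map_prod \<phi> id) (x, Y) (v, d) F = split_tvec x Y a d F"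
  proof (cases "smooth_fun M F")
    case F: True
    have "smooth_fun A (\<lambda>x'. F (x', Y))" "smooth_on (\<lambda>Y'. F (x, Y')) UNIV"
      using KM.smooth_fun_section[OF F] by (auto simp: smooth_fun_vector_space)
    then show ?thesis
      using KM.tvec_of_prod[OF F U, of UNIV id Y v d] F a
      by (simp add: split_tvec_def left_invariant_lie_deriv tvec_of_vector_space)
  qed (simp add: tvec_of_not_smooth split_tvec_def)
qed

lemma tangent_split:
  assumes V: "V \<in> tangent_space M (x, Y)"
  obtains a d where "V = split_tvec x Y a d"
proof -
  obtain U \<phi> where U: "(U, \<phi>) \<in> A" "x \<in> U" by (rule KA.chart_at)
  have c: "(U \<times> UNIV, map_prod \<phi> id) \<in> M" "(x, Y) \<in> U \<times> UNIV"
    using U by (auto intro: prod_atlasI)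
  obtain w where w: "V = tvec_of M (U \<times> UNIV, map_prod \<phi> id) (x, Y) w"
    by (rule M.tangent_space_chart[OF V c])
  obtain a where "tvec_of A (U, \<phi>) x (fst w) = left_invariant K A (L a) x"
    using tangent_left_invariant[OF KA.tvec_of_in_tangent_space[OF U]] by metis
  from tvec_of_split[OF U this, of Y "snd w"] w that show thesis by simp
qed

lemma vector_field_split:
  assumes c: "smooth_on c UNIV"
  shows "vector_field M (\<lambda>(x, Y). split_tvec x Y (c Y) d)"
proof -
  have "\<exists>v. smooth_on v (\<xi> ` W) \<and>
     (\<forall>p\<in>W. (\<lambda>(x, Y). split_tvec x Y (c Y) d) p = tvec_of M (W, \<xi>) p (v (\<xi> p)))"
    if W: "(W, \<xi>) \<in> M" for W \<xi>
  proof -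
    obtain U \<phi> where U: "(U, \<phi>) \<in> A" "W = U \<times> UNIV" "\<xi> = map_prod \<phi> id"
      using W by (auto elim!: prod_atlasE)
    have "\<exists>\<eta>. smooth_on \<eta> (\<phi> ` U) \<and> (\<forall>x\<in>U. left_invariant K A (L (e i)) x = tvec_of A (U, \<phi>) x (\<eta> (\<phi> x)))" for i
      using left_invariant_chart[OF U(1), of "e i"] by metis
    then obtain \<eta> where \<eta>: "\<And>i. smooth_on (\<eta> i) (\<phi> ` U)"
      "\<And>i x. x \<in> U \<Longrightarrow> left_invariant K A (L (e i)) x = tvec_of A (U, \<phi>) x (\<eta> i (\<phi> x))"
      by metis
    let ?S = "\<phi> ` U \<times> (UNIV :: 'g set)"
    have S: "open ?S" by (intro open_Times KA.open_chart(2)[OF U(1)] open_UNIV)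
    let ?v = "\<lambda>z. (\<Sum>i<n. (c (snd z) \<bullet> e i) *\<^sub>R \<eta> i (fst z), d)"
    have "smooth_on (\<lambda>z. c (snd z) \<bullet> e i) ?S" for i
      by (rule smooth_on_linear_comp[OF S bounded_linear_inner_left],
          rule smooth_on_compose[OF finite_dim_g S smooth_on_snd[OF S] c]) simp
    moreover have "smooth_on (\<lambda>z. \<eta> i (fst z)) ?S" for i
      by (rule smooth_on_compose[OF KA.finite_dim S smooth_on_fst[OF S] \<eta>(1)]) auto
    ultimately have "smooth_on ?v ?S"
      by (intro smooth_on_Pair smooth_on_sum smooth_on_scaleR S smooth_on_const) auto
    moreover have "split_tvec x Y (c Y) d = tvec_of M (W, \<xi>) (x, Y) (?v (\<xi> (x, Y)))" if x: "x \<in> U" for x Y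
    proof -
      have "tvec_of A (U, \<phi>) x (\<Sum>i<n. (c Y \<bullet> e i) *\<^sub>R \<eta> i (\<phi> x)) f = left_invariant K A (L (c Y)) x f" for f
      proof -
        note lin = KA.tvec_of_linear[OF U(1) x, of f]
        have "tvec_of A (U, \<phi>) x (\<Sum>i<n. (c Y \<bullet> e i) *\<^sub>R \<eta> i (\<phi> x)) f =
            (\<Sum>i<n. (c Y \<bullet> e i) * left_invariant K A (L (e i)) x f)"
          by (simp add: linear_sum[OF lin] linear_scale[OF lin] \<eta>(2)[OF x])
        then show ?thesis by (simp add: left_invariant_expansion)
      qed
      from tvec_of_split[OF U(1) x ext[OF this], of Y d] show ?thesis
        by (simp add: U(2,3))
    qed
    moreover have "\<xi> ` W = ?S" unfolding U(2,3) map_prod_image_Times by simp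
    ultimately show ?thesis
      by (intro exI[of _ ?v]) (auto simp: U(2))
  qed
  then show ?thesis unfolding vector_field_def by blast
qed

lemma smooth_fun_fst: "smooth_fun A g \<Longrightarrow> smooth_fun M (\<lambda>q. g (fst q))"
  by (rule smooth_fun_compose[OF M.smooth_atlas_axioms KA.smooth_atlas_axioms smooth_map_fst[OF KA.smooth_atlas_axioms KM.B.smooth_atlas_axioms]])

lemma smooth_fun_snd: "smooth_on g UNIV \<Longrightarrow> smooth_fun M (\<lambda>q. g (snd q))"
  by (rule smooth_fun_compose[OF M.smooth_atlas_axioms KM.B.smooth_atlas_axioms smooth_map_snd[OF KA.smooth_atlas_axioms KM.B.smooth_atlas_axioms]])
    (simp add: smooth_fun_vector_space)

lemma split_tvec_fst: "smooth_fun A g \<Longrightarrow> split_tvec x Y a d (\<lambda>q. g (fst q)) = lie_deriv a g x"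
  by (simp add: split_tvec_def smooth_fun_fst)

lemma split_tvec_snd: "smooth_on g UNIV \<Longrightarrow> split_tvec x Y a d (\<lambda>q. g (snd q)) = frechet_derivative g (at Y) d"
  by (simp add: split_tvec_def smooth_fun_snd lie_deriv_def L_const)

lemma smooth_on_inner: "smooth_on (\<lambda>Y::'g. Y \<bullet> z) UNIV"
  by (rule smooth_on_bounded_linear[OF open_UNIV bounded_linear_inner_left])

lemma split_tvec_inner: "split_tvec x Y a d (\<lambda>q. snd q \<bullet> z) = d \<bullet> z"
proof -
  have "frechet_derivative (\<lambda>Y. Y \<bullet> z) (at Y) d = d \<bullet> z"
    using frechet_derivative_at[OF bounded_linear_imp_has_derivative[OF bounded_linear_inner_left[of z]], of Y] by metis
  then show ?thesis by (simp add: split_tvec_snd[OF smooth_on_inner])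
qed

lemma split_tvec_vertical:
  "split_tvec x Y a 0 (\<lambda>q. g (snd q)) = 0"
proof (cases "smooth_fun M (\<lambda>q. g (snd q))")
  case True
  then have "smooth_on g UNIV"
    using KM.smooth_fun_section(2)[OF True] by (simp add: smooth_fun_vector_space)
  from linear_0[OF smooth_on_linear_derivative[OF this UNIV_I]] show ?thesis
    by (simp add: split_tvec_def lie_deriv_def L_const)
qed (simp add: split_tvec_def)

lemma pushforward_split: "pushforward M A fst (split_tvec x Y a d) = left_invariant K A (L a) x"
proof
  fix f
  show "pushforward M A fst (split_tvec x Y a d) f = left_invariant K A (L a) x f"
    by (cases "smooth_fun A f")
      (simp_all add: pushforward_smooth pushforward_not_smooth split_tvec_fst left_invariant_lie_deriv left_invariant_not_smooth)
qed

abbreviation \<theta> :: "('k \<times> 'g) one_form" where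
  "\<theta> \<equiv> canonical_form K A L n e"

lemma canonical_form_left_invariant:
  assumes "pushforward M A fst V = left_invariant K A (L a) x"
  shows "\<theta> (x, Y) V = Y \<bullet> a"
proof -
  have "\<theta> (x, Y) V = (\<Sum>i<n. (Y \<bullet> e i) * (a \<bullet> e i))"
    unfolding canonical_form_def cotangent_atlas_def
    by (auto simp: assms dual_frame_left_invariant intro!: sum.cong)
  then show ?thesis by (simp add: inner_expansion)
qed

lemma canonical_form_split: "\<theta> (x, Y) (split_tvec x Y a d) = Y \<bullet> a"
  by (rule canonical_form_left_invariant[OF pushforward_split])

text \<open>
  The number \<open>a q \<cdot> z\<close> is the value of \<open>X q\<close> on a coordinate function translated by the base point of
  \<open>q\<close>, so it is smooth in \<open>q\<close> by lemma \<open>smooth_fun_vector_field\<close>.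
\<close>

lemma vector_field_components:
  assumes X: "vector_field M X"
  obtains a d where "\<And>q. X q = split_tvec (fst q) (snd q) (a q) (d q)"
    "\<And>z. smooth_fun M (\<lambda>q. a q \<bullet> z)"
proof -
  have "\<exists>a d. X q = split_tvec (fst q) (snd q) a d" for q
    using M.vector_field_tangent[OF X, of q] tangent_split[of "X q" "fst q" "snd q"] by (metis prod.collapse)
  then obtain a d where ad: "\<And>q. X q = split_tvec (fst q) (snd q) (a q) (d q)" by metis
  have "smooth_fun M (\<lambda>q. a q \<bullet> z)" for z
  proof -
    let ?G = "\<lambda>z'. coordinate z (inv\<^bsub>K\<^esub> (fst (fst z')) \<otimes>\<^bsub>K\<^esub> fst (snd z'))"
    interpret MM: two_atlases M M by unfold_locales
    have f: "smooth_map M A fst"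
      by (rule smooth_map_fst[OF KA.smooth_atlas_axioms KM.B.smooth_atlas_axioms])
    have f1: "smooth_map (prod_atlas M M) A (\<lambda>z'. fst (fst z'))"
      by (rule smooth_map_compose[OF MM.smooth_atlas_AB M.smooth_atlas_axioms KA.smooth_atlas_axioms
          smooth_map_fst[OF M.smooth_atlas_axioms M.smooth_atlas_axioms] f])
    have f2: "smooth_map (prod_atlas M M) A (\<lambda>z'. fst (snd z'))"
      by (rule smooth_map_compose[OF MM.smooth_atlas_AB M.smooth_atlas_axioms KA.smooth_atlas_axioms
          smooth_map_snd[OF M.smooth_atlas_axioms M.smooth_atlas_axioms] f])
    have "smooth_fun (prod_atlas M M) ?G"
      by (rule smooth_fun_group[OF MM.smooth_atlas_AB smooth_map_mult[OF MM.smooth_atlas_AB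
            smooth_map_inv[OF MM.smooth_atlas_AB f1] f2] coordinate(1)])
    from M.smooth_fun_vector_field[OF X this]
    have "smooth_fun M (\<lambda>q. X q (\<lambda>q'. coordinate z (inv\<^bsub>K\<^esub> fst q \<otimes>\<^bsub>K\<^esub> fst q')))" by simp
    moreover have "X q (\<lambda>q'. coordinate z (inv\<^bsub>K\<^esub> fst q \<otimes>\<^bsub>K\<^esub> fst q')) = a q \<bullet> z" for q
      using left_invariant_coordinate[of "a q" "fst q" z]
        split_tvec_fst[OF smooth_fun_mult_left[OF coordinate(1)], of "fst q" "snd q" "a q" "d q" z "inv\<^bsub>K\<^esub> fst q"]
      unfolding ad by (simp add: smooth_fun_mult_left coordinate(1) left_invariant_lie_deriv)
    ultimately show ?thesis by simp
  qed
  then show thesis using that ad by blast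
qed

lemma lie_deriv_lie_deriv_expansion:
  assumes g: "smooth_fun A g"
  shows "(\<Sum>i<n. (b \<bullet> e i) * lie_deriv a (lie_deriv (e i) g) x) = lie_deriv a (lie_deriv b g) x"
proof -
  have s: "smooth_fun A (\<lambda>y. lie_deriv (e i) g (x \<otimes>\<^bsub>K\<^esub> y))" for i
    by (rule smooth_fun_mult_left[OF smooth_lie_deriv[OF g]])
  have "lie_deriv a (lie_deriv b g) x = L a (\<lambda>y. \<Sum>i<n. (b \<bullet> e i) * lie_deriv (e i) g (x \<otimes>\<^bsub>K\<^esub> y))"
    unfolding lie_deriv_expansion by (simp add: lie_deriv_def[of a])
  also have "\<dots> = (\<Sum>i<n. (b \<bullet> e i) * L a (\<lambda>y. lie_deriv (e i) g (x \<otimes>\<^bsub>K\<^esub> y)))"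
    by (simp add: KA.tangent_sum[OF L_tangent] KA.tangent_cmult[OF L_tangent] KA.smooth_fun_mult s)
  finally show ?thesis by (simp add: lie_deriv_def[of a])
qed

text \<open>
  Since \<open>\<theta>(Z) = Y \<cdot> a'\<close>, the product rule gives \<open>X(\<theta>(Z)) = d \<cdot> a' + Y \<cdot> X(a')\<close>, and likewise for
  \<open>Z(\<theta>(X))\<close>.  The component of the commutator of \<open>X\<close> and \<open>Z\<close> along \<open>K\<close> is \<open>X(a') - Z(a) + [a, a']\<close>;
  to find it, the commutator is applied to functions pulled back from \<open>K\<close>, which the components
  \<open>d\<close> and \<open>d'\<close> do not see.  The derivatives of \<open>a\<close> and \<open>a'\<close> cancel.
\<close>

lemma ext_deriv_canonical_form:
  assumes X: "vector_field M X" "\<And>q. X q = split_tvec (fst q) (snd q) (a q) (d q)" "\<And>z. smooth_fun M (\<lambda>q. a q \<bullet> z)"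
    and Z: "vector_field M Z" "\<And>q. Z q = split_tvec (fst q) (snd q) (a' q) (d' q)" "\<And>z. smooth_fun M (\<lambda>q. a' q \<bullet> z)"
  shows "ext_deriv \<theta> X Z p = d p \<bullet> a' p - d' p \<bullet> a p - snd p \<bullet> bracket (a p) (a' p)"
proof -
  have first: "X p (\<lambda>q. \<theta> q (Z q)) = (\<Sum>i<n. (snd p \<bullet> e i) * X p (\<lambda>q. a' q \<bullet> e i)) + d p \<bullet> a' p"
    if X: "vector_field M X" "\<And>q. X q = split_tvec (fst q) (snd q) (a q) (d q)"
      and Z: "\<And>q. Z q = split_tvec (fst q) (snd q) (a' q) (d' q)" "\<And>z. smooth_fun M (\<lambda>q. a' q \<bullet> z)"
    for X Z a d a' d'
  proof -
    note Xp = M.vector_field_tangent[OF X(1), of p]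
    have s: "smooth_fun M (\<lambda>q. snd q \<bullet> z)" for z
      by (rule smooth_fun_snd[OF smooth_on_inner])
    have "\<theta> q (Z q) = (\<Sum>i<n. (snd q \<bullet> e i) * (a' q \<bullet> e i))" for q
      using canonical_form_split[of "fst q" "snd q"] by (simp add: Z(1) inner_expansion)
    then have "X p (\<lambda>q. \<theta> q (Z q)) = X p (\<lambda>q. \<Sum>i<n. (snd q \<bullet> e i) * (a' q \<bullet> e i))"
      by presburger
    also have "\<dots> = (\<Sum>i<n. (snd p \<bullet> e i) * X p (\<lambda>q. a' q \<bullet> e i) + X p (\<lambda>q. snd q \<bullet> e i) * (a' p \<bullet> e i))"
      by (simp add: M.tangent_sum[OF Xp] M.tangent_mult[OF Xp] M.smooth_fun_mult s Z(2))
    finally show ?thesis by (simp add: sum.distrib inner_expansion X(2)[of p] split_tvec_inner)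
  qed
  have second: "X p (\<lambda>q. Z q (\<lambda>q'. g (fst q'))) =
      lie_deriv (a p) (lie_deriv (a' p) g) (fst p) + (\<Sum>i<n. X p (\<lambda>q. a' q \<bullet> e i) * lie_deriv (e i) g (fst p))"
    if X: "vector_field M X" "\<And>q. X q = split_tvec (fst q) (snd q) (a q) (d q)"
      and Z: "\<And>q. Z q = split_tvec (fst q) (snd q) (a' q) (d' q)" "\<And>z. smooth_fun M (\<lambda>q. a' q \<bullet> z)"
      and g: "smooth_fun A g"
    for X Z a d a' d' g
  proof -
    note Xp = M.vector_field_tangent[OF X(1), of p]
    have s: "smooth_fun M (\<lambda>q. lie_deriv (e i) g (fst q))" for i
      by (rule smooth_fun_fst[OF smooth_lie_deriv[OF g]])
    have "X p (\<lambda>q. Z q (\<lambda>q'. g (fst q'))) = X p (\<lambda>q. \<Sum>i<n. (a' q \<bullet> e i) * lie_deriv (e i) g (fst q))"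
      by (simp add: Z(1) split_tvec_fst[OF g] lie_deriv_expansion)
    also have "\<dots> = (\<Sum>i<n. (a' p \<bullet> e i) * X p (\<lambda>q. lie_deriv (e i) g (fst q)) + X p (\<lambda>q. a' q \<bullet> e i) * lie_deriv (e i) g (fst p))"
      by (simp add: M.tangent_sum[OF Xp] M.tangent_mult[OF Xp] M.smooth_fun_mult s Z(2))
    finally show ?thesis
      by (simp add: sum.distrib X(2)[of p] split_tvec_fst[OF smooth_lie_deriv[OF g]]
          lie_deriv_lie_deriv_expansion[OF g])
  qed
  define b where "b = (\<Sum>i<n. (X p (\<lambda>q. a' q \<bullet> e i) - Z p (\<lambda>q. a q \<bullet> e i)) *\<^sub>R e i) + bracket (a p) (a' p)"
  have "pushforward M A fst (lie_bracket X Z p) = left_invariant K A (L b) (fst p)"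
  proof
    fix g
    show "pushforward M A fst (lie_bracket X Z p) g = left_invariant K A (L b) (fst p) g"
    proof (cases "smooth_fun A g")
      case g: True
      have "lie_deriv b g (fst p) = (\<Sum>i<n. (X p (\<lambda>q. a' q \<bullet> e i) - Z p (\<lambda>q. a q \<bullet> e i)) * lie_deriv (e i) g (fst p))
          + lie_deriv (bracket (a p) (a' p)) g (fst p)"
        by (simp add: b_def lie_deriv_def linear_add[OF L_linear] L_sum)
      then show ?thesis
        using second[OF X(1,2) Z(2,3) g] second[OF Z(1,2) X(2,3) g] lie_deriv_bracket[OF g, of "a p" "a' p" "fst p"]
        by (simp add: pushforward_smooth[OF g] left_invariant_lie_deriv[OF g] lie_bracket_def vf_apply_def
            left_diff_distrib sum_subtractf)
    qed (simp add: pushforward_not_smooth left_invariant_not_smooth)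
  qed
  then have "\<theta> p (lie_bracket X Z p) = snd p \<bullet> b"
    using canonical_form_left_invariant[of "lie_bracket X Z p" b "fst p" "snd p"] by simp
  also have "\<dots> = (\<Sum>i<n. (snd p \<bullet> e i) * X p (\<lambda>q. a' q \<bullet> e i)) - (\<Sum>i<n. (snd p \<bullet> e i) * Z p (\<lambda>q. a q \<bullet> e i))
      + snd p \<bullet> bracket (a p) (a' p)"
    by (simp add: b_def inner_add_right inner_sum_right left_diff_distrib right_diff_distrib sum_subtractf mult.commute)
  finally show ?thesis
    using first[OF X(1,2) Z(2,3)] first[OF Z(1,2) X(2,3)] by (simp add: ext_deriv_def)
qed

section \<open>The Hamiltonian field of an invariant function\<close>

lemma smooth_on_grad:
  assumes "smooth_on h UNIV"
  shows "smooth_on (grad n e h) UNIV"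
proof -
  have "smooth_on (\<lambda>Y. \<Sum>i<n. frechet_derivative h (at Y) (e i) *\<^sub>R e i) UNIV"
    by (rule smooth_on_sum[OF open_UNIV finite_lessThan],
        rule smooth_on_linear_comp[OF open_UNIV bounded_linear_scaleR_left],
        rule smooth_on_derivative[OF assms])
  then show ?thesis by (simp add: grad_def[abs_def] partial_def)
qed

definition ham_field :: "('g \<Rightarrow> real) \<Rightarrow> 'k \<times> 'g \<Rightarrow> ('k \<times> 'g) tvec" where
  "ham_field h = (\<lambda>(x, Y). split_tvec x Y (grad n e h Y) 0)"

lemma split_components_smooth:
  assumes c: "smooth_on c UNIV"
  shows "smooth_fun M (\<lambda>q. c (snd q) \<bullet> z)"
  by (rule smooth_fun_snd[OF smooth_on_linear_comp[OF open_UNIV bounded_linear_inner_left c]])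

text \<open>
  For uniqueness, the fields with constant components \<open>(b, c)\<close> suffice as test fields: \<open>(0, c)\<close>
  determines the component of \<open>X\<close> along \<open>K\<close>, and \<open>(b, 0)\<close> the one along \<open>Lie(K)\<close>.
\<close>

theorem is_hamiltonian_field_iff:
  assumes h: "smooth_on h UNIV" and inv: "\<And>g Y. h (ad_action g Y) = h Y"
  shows "is_hamiltonian_field M \<theta> (\<lambda>p. h (snd p)) X \<longleftrightarrow> X = ham_field h"
proof
  have grad_deriv: "split_tvec x Y a d (\<lambda>p. h (snd p)) = grad n e h Y \<bullet> d" for x Y a d
    by (simp add: split_tvec_snd[OF h] grad_inner[OF h])
  have zero: "Y \<bullet> bracket (grad n e h Y) a = 0" for Y a
    using grad_bracket[OF h inv, of Y a] bracket_antisym[of "grad n e h Y" a] by simp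
  have bracket_zero: "bracket a 0 = 0" for a
  proof -
    have "L (bracket a 0) f = L 0 f" for f
    proof (cases "smooth_fun A f")
      case True
      have "lie_deriv 0 f = (\<lambda>x. 0)" by (simp add: lie_deriv_def L_zero fun_eq_iff)
      then show ?thesis using bracket_at_one[OF True, of a 0] by (simp add: L_zero L_const)
    qed (simp add: tangent_space_not_smooth[OF L_tangent])
    then have "L (bracket a 0) = L 0" ..
    then show ?thesis by (simp add: L_inj)
  qed
  {
    assume ham: "is_hamiltonian_field M \<theta> (\<lambda>p. h (snd p)) X"
    then have X: "vector_field M X" by (simp add: is_hamiltonian_field_def)
    obtain a d where ad: "\<And>q. X q = split_tvec (fst q) (snd q) (a q) (d q)" "\<And>z. smooth_fun M (\<lambda>q. a q \<bullet> z)"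
      by (rule vector_field_components[OF X]) blast
    have key: "- (d p \<bullet> b - c \<bullet> a p - snd p \<bullet> bracket (a p) b) = grad n e h (snd p) \<bullet> c" for b c p
    proof -
      let ?Z = "\<lambda>(x, Y). split_tvec x Y b c"
      have Z: "vector_field M ?Z" using vector_field_split[of "\<lambda>Y. b" c] by simp
      have "- ext_deriv \<theta> X ?Z p = ?Z p (\<lambda>p. h (snd p))"
        using ham Z unfolding is_hamiltonian_field_def by blast
      moreover have "ext_deriv \<theta> X ?Z p = d p \<bullet> b - c \<bullet> a p - snd p \<bullet> bracket (a p) b"
        by (rule ext_deriv_canonical_form[OF X ad Z]) (auto simp: case_prod_beta)
      ultimately show ?thesis by (simp add: case_prod_beta grad_deriv)
    qed
    have a: "a p = grad n e h (snd p)" for p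
    proof -
      have "c \<bullet> (a p - grad n e h (snd p)) = 0" for c
        using key[of p 0 c] by (simp add: bracket_zero inner_diff_right inner_commute)
      then show ?thesis by (metis inner_eq_zero_iff right_minus_eq)
    qed
    have "d p = 0" for p
      using key[of p "d p" 0] zero[of "snd p" "d p"] by (simp add: a)
    then show "X = ham_field h"
      by (auto simp: fun_eq_iff ham_field_def ad(1) a)
  next
    assume X: "X = ham_field h"
    have vf: "vector_field M (ham_field h)"
      unfolding ham_field_def by (rule vector_field_split[OF smooth_on_grad[OF h]])
    have "- ext_deriv \<theta> (ham_field h) Z p = Z p (\<lambda>p. h (snd p))" if Z: "vector_field M Z" for Z p
    proof -
      obtain a d where ad: "\<And>q. Z q = split_tvec (fst q) (snd q) (a q) (d q)" "\<And>z. smooth_fun M (\<lambda>q. a q \<bullet> z)"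
        by (rule vector_field_components[OF Z]) blast
      have "ext_deriv \<theta> (ham_field h) Z p = 0 \<bullet> a p - d p \<bullet> grad n e h (snd p) - snd p \<bullet> bracket (grad n e h (snd p)) (a p)"
        by (rule ext_deriv_canonical_form[OF vf _ _ Z ad])
          (auto simp: ham_field_def case_prod_beta split_components_smooth[OF smooth_on_grad[OF h]])
      then show ?thesis by (simp add: zero ad(1) grad_deriv inner_commute)
    qed
    then show "is_hamiltonian_field M \<theta> (\<lambda>p. h (snd p)) X"
      using vf by (simp add: is_hamiltonian_field_def X)
  }
qed

lemma ham_field_vertical: "ham_field h p (\<lambda>q. g (snd q)) = 0"
  by (simp add: ham_field_def case_prod_beta split_tvec_vertical)

lemma canonical_form_ham_field: "\<theta> p (ham_field h p) = snd p \<bullet> grad n e h (snd p)"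
  using canonical_form_split[of "fst p" "snd p" "grad n e h (snd p)" 0] by (simp add: ham_field_def case_prod_beta)

end

section \<open>Lie series and analytic continuation\<close>

lemma vf_apply_zero_iterates:
  assumes "\<And>p. X p f = 0" "\<And>p. X p (\<lambda>q. 0) = 0"
  shows "(vf_apply X ^^ Suc k) f = (\<lambda>p. 0)"
  by (induction k) (auto simp: vf_apply_def assms)

lemma lie_term_constant:
  assumes "\<And>p. X p f = 0" "\<And>p. X p (\<lambda>q. 0) = 0"
  shows "lie_term \<tau> X f p = (\<lambda>k. if k = 0 then complex_of_real (f p) else 0)"
proof
  fix k show "lie_term \<tau> X f p k = (if k = 0 then complex_of_real (f p) else 0)"
    using vf_apply_zero_iterates[of X f, OF assms] by (cases k) (auto simp: lie_term_def simp del: funpow.simps(2))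
qed

lemma lie_series_constant:
  assumes "\<And>p. X p f = 0" "\<And>p. X p (\<lambda>q. 0) = 0"
  shows "summable (lie_term \<tau> X f p)" "lie_series \<tau> X f p = complex_of_real (f p)"
proof -
  have "(\<lambda>k. if k = 0 then complex_of_real (f p) else 0) sums complex_of_real (f p)"
    using sums_If_finite_set[of "{0}" "\<lambda>k. complex_of_real (f p)"] by simp
  then have "lie_term \<tau> X f p sums complex_of_real (f p)"
    by (simp add: lie_term_constant[of X f, OF assms])
  then show "summable (lie_term \<tau> X f p)" "lie_series \<tau> X f p = complex_of_real (f p)"
    by (auto simp: lie_series_def sums_iff)
qed

text \<open>
  The identity theorem applies because the real line lies in the domain and accumulates at 0.
\<close>

lemma continuation_value_linear:
  "continuation_value (\<lambda>t. complex_of_real t * c) \<tau> w \<longleftrightarrow> w = \<tau> * c"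
proof
  assume "continuation_value (\<lambda>t. complex_of_real t * c) \<tau> w"
  then obtain D g where D: "open D" "connected D" "\<real> \<subseteq> D" "\<tau> \<in> D" "g holomorphic_on D"
    "\<And>t::real. g (complex_of_real t) = complex_of_real t * c" "w = g \<tau>"
    unfolding continuation_value_def by auto
  have lim: "(0::complex) islimpt \<real>"
  proof (rule islimptI)
    fix T :: "complex set" assume "0 \<in> T" "open T"
    then obtain r where r: "r > 0" "ball 0 r \<subseteq> T" using openE by blast
    then have "complex_of_real (r / 2) \<in> \<real> \<inter> T" "complex_of_real (r / 2) \<noteq> 0"
      by (auto simp: dist_norm subset_iff)
    then show "\<exists>y\<in>\<real>. y \<in> T \<and> y \<noteq> 0" by blast
  qed
  have "g \<tau> - \<tau> * c = 0"
  proof (rule analytic_continuation[of "\<lambda>z. g z - z * c" D \<real> 0, OF _ D(1-3) _ lim _ D(4)])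
    show "(\<lambda>z. g z - z * c) holomorphic_on D"
      using D(5) by (intro holomorphic_intros)
    show "0 \<in> D" using D(3) Reals_0 by blast
    show "g z - z * c = 0" if "z \<in> \<real>" for z
      using that D(6) by (metis Reals_cases diff_self)
  qed
  then show "w = \<tau> * c" using D by simp
next
  assume "w = \<tau> * c"
  then show "continuation_value (\<lambda>t. complex_of_real t * c) \<tau> w"
    unfolding continuation_value_def
    by (intro exI[of _ UNIV] exI[of _ "\<lambda>z. z * c"]) (auto intro!: holomorphic_intros)
qed

theorem proposition10p4:
  fixes K :: "'k::{t2_space, second_countable_topology} monoid"
    and A :: "('k, 'e::real_inner) atlas"
    and L :: "'g::real_inner \<Rightarrow> 'k tvec"
    and n :: nat and e :: "nat \<Rightarrow> 'g"
    and h :: "'g \<Rightarrow> real" and \<tau> :: complex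
  assumes "compact_lie_group K A"
    and "lie_algebra_iso K A L"
    and "\<And>g Y Z. Ad K A L g Y \<bullet> Ad K A L g Z = Y \<bullet> Z"
    and "orthonormal_basis n e"
    and "smooth_on h UNIV"
    and "\<And>g Y. h (Ad K A L g Y) = h Y"
    and "strictly_convex h"
    and "\<And>Y. bij (hessian n e h Y)"
    and "\<exists>C. \<forall>Y. onorm (the_inv (hessian n e h Y)) \<le> C"
    and "Im \<tau> > -1"
  shows "let M = cotangent_atlas A;
             \<theta> = canonical_form K A L n e;
             H = (\<lambda>p::'k \<times> 'g. h (snd p));
             X = hamiltonian_field M \<theta> H;
             \<theta>X = (\<lambda>q. \<theta> q (X q));
             \<kappa> = kappa n e h;
             \<alpha> = (\<lambda>p t. LBINT s=0..ereal t. lie_series (complex_of_real s) X \<theta>X p);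
             \<psi> = (\<lambda>p. - (\<i> / 2) * lie_series \<tau> X (\<kappa> 0) p + \<tau> * complex_of_real (H p)
                      - continuation (\<alpha> p) \<tau>)
         in (\<exists>!X. is_hamiltonian_field M \<theta> H X) \<and>
            (\<forall>p. summable (lie_term \<tau> X (\<kappa> 0) p)) \<and>
            (\<forall>p s. summable (lie_term (complex_of_real s) X \<theta>X p)) \<and>
            (\<forall>p t. interval_lebesgue_integrable lborel 0 (ereal t)
                     (\<lambda>s. lie_series (complex_of_real s) X \<theta>X p)) \<and>
            (\<forall>p. \<exists>!w. continuation_value (\<alpha> p) \<tau> w) \<and>
            (\<forall>p. \<kappa> \<tau> p = - 2 * Im (\<psi> p))"
proof -
  interpret compact_lie_group K A by fact
  interpret metric_lie_group K A L n e
    using assms(2-4) by unfold_locales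
  let ?M = "cotangent_atlas A :: ('k \<times> 'g, 'e \<times> 'g) atlas" and ?\<theta> = "canonical_form K A L n e"
  let ?H = "\<lambda>p::'k \<times> 'g. h (snd p)" and ?X = "ham_field h" and ?\<kappa> = "kappa n e h"
  let ?\<theta>X = "\<lambda>q. ?\<theta> q (?X q)"
  define c where "c p = snd p \<bullet> grad n e h (snd p)" for p :: "'k \<times> 'g"
  have ham: "is_hamiltonian_field ?M ?\<theta> ?H X \<longleftrightarrow> X = ?X" for X
    unfolding cotangent_atlas_def by (rule is_hamiltonian_field_iff[OF assms(5,6)])
  then have ex1: "\<exists>!X. is_hamiltonian_field ?M ?\<theta> ?H X" and X: "hamiltonian_field ?M ?\<theta> ?H = ?X"
    by (auto simp: hamiltonian_field_def)
  have zero: "?X p (\<lambda>q. 0) = 0" for p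
    using ham_field_vertical[of h p "\<lambda>Y. 0"] by simp
  have \<kappa>: "?\<kappa> 0 = (\<lambda>p. 2 * (snd p \<bullet> grad n e h (snd p) - h (snd p)))"
    by (auto simp: kappa_def)
  have "?X p (?\<kappa> 0) = 0" for p
    unfolding \<kappa> using ham_field_vertical[of h p "\<lambda>Y. 2 * (Y \<bullet> grad n e h Y - h Y)"] .
  note \<kappa>_series = lie_series_constant[of ?X "?\<kappa> 0", OF this zero]
  have \<theta>X: "?\<theta>X = c" by (auto simp: canonical_form_ham_field c_def)
  have "?X p c = 0" for p
    using ham_field_vertical[of h p "\<lambda>Y. Y \<bullet> grad n e h Y"] by (simp add: c_def[abs_def])
  note c_series = lie_series_constant[of ?X c, OF this zero]
  have int: "interval_lebesgue_integrable lborel 0 (ereal t) (\<lambda>s. complex_of_real (c p))" for t p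
    unfolding zero_ereal_def by (rule interval_integrable_isCont) simp
  have \<alpha>: "(LBINT s=0..ereal t. complex_of_real (c p)) = complex_of_real t * complex_of_real (c p)" for t p
    using interval_integral_const[of 0 t "c p"]
    by (simp add: interval_lebesgue_integral_of_real zero_ereal_def)
  have cont: "continuation (\<lambda>t. complex_of_real t * complex_of_real (c p)) \<tau> = \<tau> * complex_of_real (c p)" for p
    by (simp add: continuation_def continuation_value_linear)
  have final: "?\<kappa> \<tau> p = - 2 * Im (- (\<i> / 2) * complex_of_real (?\<kappa> 0 p) + \<tau> * complex_of_real (?H p) - \<tau> * complex_of_real (c p))" for p
    by (cases p) (simp add: kappa_def c_def algebra_simps)
  show ?thesis
    unfolding Let_def X \<theta>X c_series(2) \<alpha> cont \<kappa>_series(2)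
    using ex1 \<kappa>_series(1) c_series(1) int final by (auto simp: continuation_value_linear)
qed

end
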